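(* $\mathsf{BinStoch}^{\otimes\infty}_{\mathrm{expl}}$ is equivalent to $\mathsf{CantorStoch}_{\mathsf{lc}}$, the full subcategory of $\mathsf{StoneStoch}_{\mathsf{lc}}$ in which objects are $2^N=\{0,1\}^N$, where $N$ is any natural number or $\mathbb{N}$.
   Context: $\mathsf{BinStoch}$: objects are the finite powers $2^n$ of $2=\{0,1\}$, $n\in\mathbb{N}$; morphisms $f\colon X\to Y$ are functions $(y,x)\mapsto f(y\mid x)\in\mathbb{R}^{\ge0}$ with $\sum_{y\in Y}f(y\mid x)=1$ for all $x\in X$; composition $gf(z\mid x)=\sum_y g(z\mid y)f(y\mid x)$; tensor is the product of sets with $(f\otimes h)(y,w\mid x,z)=f(y\mid x)h(w\mid z)$; the unit is $I=2^0$. It is semicartesian (symmetric monoidal with $I$ terminal; $\mathrm{del}_X\colon X\to I$ the unique morphism) with cancellative deletions ($f\otimes\mathrm{del}_X=g\otimes\mathrm{del}_X$ implies $f=g$). A Stone space is a compact Hausdorff space with a basis of clopen sets; $\mathsf{Clopen}(X)$ denotes its clopen sets. A locally constant Markov kernel $f$ from $X$ to $Y$ (Stone spaces) is a function $f\colon\mathsf{Clopen}(Y)\times X\to[0,1]$, $(U,x)\mapsto f(U\mid x)$, such that (i) for every $U\in\mathsf{Clopen}(Y)$, $f(U\mid-)$ is locally constant on $X$; (ii) for every $x\in X$, $f(-\mid x)$ is a finitely additive probability measure on $\mathsf{Clopen}(Y)$. $\mathsf{StoneStoch}_{\mathsf{lc}}$ has Stone spaces as objects and locally constant Markov kernels as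 morphisms, with composition $gf(V\mid x):=\int_Y g(V\mid y)f(dy\mid x)$, i.e. $\sum_i g(V\mid U_i)f(U_i\mid x)$ for any finite clopen partition $\{U_i\}$ of $Y$ on whose (nonempty) members $g(V\mid-)$ is constant. Here $2^n$ is discrete and $2^{\mathbb{N}}$ is the Cantor space (product topology). Let $\mathsf{C}$ be semicartesian with cancellative deletions. For a countable set $J$, $\mathsf{FinLO}(J)$ is the category whose objects are finite linearly ordered subsets of $J$, with a morphism $F\to F'$ whenever $F$ is an ordered subset of $F'$ (i.e. $F$ is contained in $F'$ and the inclusion preserves the order); such a morphism is written $F\subseteq F'$. The abstract infinite tensor product of a family $(X_j)_{j\in J}$ is the functor $X\colon\mathsf{FinLO}(J)^{\mathrm{op}}\to\mathsf{C}$, $F\mapsto X_F:=\bigotimes_{j\in F}X_j$, sending $F\subseteq F'$ to the morphism $\pi_{F',F}\colon X_{F'}\to X_F$ which deletes all factors $j\in F'\setminus F$ and keeps the rest unchanged (up to permutation, $\mathrm{id}_{X_F}\otimes\mathrm{del}_{X_{F'\setminus F}}$). One writes $J_X$ for $J$. A finite approximation family $f\colon X\to Y$ consists of an index set $\Lambda_f\subseteq \mathsf{FinLO}(J_X)\times\mathsf{FinLO}(J_Y)$ (pairs of objects) and morphisms $(f_{F,G}\colon X_F\to Y_G)_{(F,G)\in\Lambda_f}$ such that: (Naturality) for $F'\supseteq F$, $G'\supseteq G$ with $(F,G),(F',G')\in\Lambda_f$, $\pi_{G',G}f_{F',G'}=f_{F,G}\pi_{F',F}$; (Covering) for every $G$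 there is $F$ with $(F,G)\in\Lambda_f$; (Hereditariness) if $(F,G)\in\Lambda_f$ then $(F',G)\in\Lambda_f$ for every $F'\supseteq F$. Two families are equivalent if they agree on the intersection of their index sets. Fix an element $*$. The category $\mathsf{C}^{\otimes\infty}_{\mathrm{expl}}$ has as objects the abstract infinite tensor products $X$ in $\mathsf{C}$ with $J_X$ countable and $*\in J_X$, as morphisms the equivalence classes of finite approximation families, and composition $(gf)_{F,H}:=g_{G,H}f_{F,G}$ whenever $(F,G)\in\Lambda_f$, $(G,H)\in\Lambda_g$ for some $G$.
   Formalization: Finite subsets of J carry the order induced from one fixed linear order on the indices (with arbitrary orders on each finite subset, composition of families is ill-defined); index sets J are the countable subsets, containing *, of an arbitrary infinite linearly ordered set. *)

theory Defs
  imports "HOL-Analysis.Analysis"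
begin

section \<open>Categories and equivalence of categories\<close>

record ('o, 'm) cat =
  Obj :: "'o set"
  Mor :: "'m set"
  Dom :: "'m \<Rightarrow> 'o"
  Cod :: "'m \<Rightarrow> 'o"
  Idn :: "'o \<Rightarrow> 'm"
  Comp :: "'m \<Rightarrow> 'm \<Rightarrow> 'm"  \<comment> \<open>\<open>Comp C g f\<close> is \<open>g\<close> after \<open>f\<close>\<close>

definition hom :: "('o, 'm, 'z) cat_scheme \<Rightarrow> 'o \<Rightarrow> 'o \<Rightarrow> 'm set" where
  "hom C A B = {f \<in> Mor C. Dom C f = A \<and> Cod C f = B}"

locale category =
  fixes C :: "('o, 'm, 'z) cat_scheme"
  assumes Dom_Obj: "f \<in> Mor C \<Longrightarrow> Dom C f \<in> Obj C"
    and Cod_Obj: "f \<in> Mor C \<Longrightarrow> Cod C f \<in> Obj C"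
    and Idn_hom: "A \<in> Obj C \<Longrightarrow> Idn C A \<in> hom C A A"
    and Comp_hom: "f \<in> hom C A B \<Longrightarrow> g \<in> hom C B D \<Longrightarrow> Comp C g f \<in> hom C A D"
    and Comp_Idn_left: "f \<in> hom C A B \<Longrightarrow> Comp C (Idn C B) f = f"
    and Comp_Idn_right: "f \<in> hom C A B \<Longrightarrow> Comp C f (Idn C A) = f"
    and Comp_assoc: "f \<in> hom C A B \<Longrightarrow> g \<in> hom C B D \<Longrightarrow> h \<in> hom C D E \<Longrightarrow>
      Comp C h (Comp C g f) = Comp C (Comp C h g) f"

locale cat_functor = source: category C + target: category D
  for C :: "('o1, 'm1, 'z1) cat_scheme" and D :: "('o2, 'm2, 'z2) cat_scheme" +
  fixes Fo :: "'o1 \<Rightarrow> 'o2" and Fm :: "'m1 \<Rightarrow> 'm2"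
  assumes F_Obj: "A \<in> Obj C \<Longrightarrow> Fo A \<in> Obj D"
    and F_hom: "f \<in> hom C A B \<Longrightarrow> Fm f \<in> hom D (Fo A) (Fo B)"
    and F_Idn: "A \<in> Obj C \<Longrightarrow> Fm (Idn C A) = Idn D (Fo A)"
    and F_Comp: "f \<in> hom C A B \<Longrightarrow> g \<in> hom C B E \<Longrightarrow>
      Fm (Comp C g f) = Comp D (Fm g) (Fm f)"

definition isomorphism :: "('o, 'm, 'z) cat_scheme \<Rightarrow> 'o \<Rightarrow> 'o \<Rightarrow> 'm \<Rightarrow> bool" where
  "isomorphism C A B f \<longleftrightarrow> f \<in> hom C A B \<and>
     (\<exists>g \<in> hom C B A. Comp C g f = Idn C A \<and> Comp C f g = Idn C B)"

definition natural_isomorphism ::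
  "('o1, 'm1, 'z1) cat_scheme \<Rightarrow> ('o2, 'm2, 'z2) cat_scheme \<Rightarrow>
   ('o1 \<Rightarrow> 'o2) \<Rightarrow> ('m1 \<Rightarrow> 'm2) \<Rightarrow> ('o1 \<Rightarrow> 'o2) \<Rightarrow> ('m1 \<Rightarrow> 'm2) \<Rightarrow> ('o1 \<Rightarrow> 'm2) \<Rightarrow> bool" where
  "natural_isomorphism C D Fo Fm Go Gm t \<longleftrightarrow>
     cat_functor C D Fo Fm \<and> cat_functor C D Go Gm \<and>
     (\<forall>A \<in> Obj C. isomorphism D (Fo A) (Go A) (t A)) \<and>
     (\<forall>A \<in> Obj C. \<forall>B \<in> Obj C. \<forall>f \<in> hom C A B.
        Comp D (t B) (Fm f) = Comp D (Gm f) (t A))"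

definition equivalent_categories ::
  "('o1, 'm1, 'z1) cat_scheme \<Rightarrow> ('o2, 'm2, 'z2) cat_scheme \<Rightarrow> bool" where
  "equivalent_categories C D \<longleftrightarrow>
     category C \<and> category D \<and>
     (\<exists>Fo Fm Go Gm s t.
        cat_functor C D Fo Fm \<and> cat_functor D C Go Gm \<and>
        natural_isomorphism C C id id (Go \<circ> Fo) (Gm \<circ> Fm) s \<and>
        natural_isomorphism D D (Fo \<circ> Go) (Fm \<circ> Gm) id id t)"

definition full_subcategory :: "('o, 'm) cat \<Rightarrow> 'o set \<Rightarrow> ('o, 'm) cat" where
  "full_subcategory C S =
     C\<lparr>Obj := Obj C \<inter> S, Mor := {f \<in> Mor C. Dom C f \<in> S \<and> Cod C f \<in> S}\<rparr>"

text \<open>Morphisms that record their domain and codomain; used in all concrete categories below.\<close>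

datatype ('o, 'a) arr = Arr (src: 'o) (tgt: 'o) (act: 'a)


section \<open>The category \<open>BinStoch\<close>\<close>

text \<open>The monoidal data from which finite tensor products and deletions are built. A
  semicartesian category also has an associator, a right unitor and a symmetry; the construction
  below does not refer to them, because finite tensor products are bracketed to the right
  and factors are never permuted.\<close>

record ('o, 'm) tensor_cat = "('o, 'm) cat" +
  Unit :: "'o"
  TenO :: "'o \<Rightarrow> 'o \<Rightarrow> 'o"
  TenM :: "'m \<Rightarrow> 'm \<Rightarrow> 'm"
  LUnit :: "'o \<Rightarrow> 'm"  \<comment> \<open>the left unitor, from \<open>TenO C (Unit C) A\<close> to \<open>A\<close>\<close>

definition del :: "('o, 'm, 'z) tensor_cat_scheme \<Rightarrow> 'o \<Rightarrow> 'm" where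
  "del C A = (THE f. f \<in> hom C A (Unit C))"

definition bin_pow :: "nat \<Rightarrow> bool list set" where
  "bin_pow n = {x. length x = n}"

text \<open>\<open>f y x\<close> stands for \<open>f(y | x)\<close>. Matrices vanish outside \<open>bin_pow n \<times> bin_pow m\<close>, so that
  equality of HOL functions is equality of morphisms.\<close>

definition stochastic :: "nat \<Rightarrow> nat \<Rightarrow> (bool list \<Rightarrow> bool list \<Rightarrow> real) \<Rightarrow> bool" where
  "stochastic m n f \<longleftrightarrow>
     (\<forall>y x. 0 \<le> f y x) \<and>
     (\<forall>x \<in> bin_pow m. (\<Sum>y \<in> bin_pow n. f y x) = 1) \<and>
     (\<forall>y x. \<not> (y \<in> bin_pow n \<and> x \<in> bin_pow m) \<longrightarrow> f y x = 0)"

text \<open>The object \<open>n\<close> is the set \<open>2\<^sup>n\<close>. The product of \<open>2\<^sup>m\<close> and \<open>2\<^sup>n\<close> is identified with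
  \<open>2\<^sup>m\<^sup>+\<^sup>n\<close> by concatenation, which makes the unitors identities.\<close>

definition BinStoch ::
  "(nat, (nat, bool list \<Rightarrow> bool list \<Rightarrow> real) arr) tensor_cat" where
  "BinStoch = \<lparr>
     Obj = UNIV,
     Mor = {f. stochastic (src f) (tgt f) (act f)},
     Dom = src,
     Cod = tgt,
     Idn = (\<lambda>n. Arr n n (\<lambda>y x. if y = x \<and> x \<in> bin_pow n then 1 else 0)),
     Comp = (\<lambda>g f. Arr (src f) (tgt g) (\<lambda>z x. \<Sum>y \<in> bin_pow (tgt f). act g z y * act f y x)),
     Unit = 0,
     TenO = (+),
     TenM = (\<lambda>f h. Arr (src f + src h) (tgt f + tgt h)
       (\<lambda>y x. act f (take (tgt f) y) (take (src f) x) *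
              act h (drop (tgt f) y) (drop (src f) x))),
     LUnit = (\<lambda>n. Arr n n (\<lambda>y x. if y = x \<and> x \<in> bin_pow n then 1 else 0))\<rparr>"


section \<open>Explicit infinite tensor products\<close>

text \<open>Indices live in a linearly ordered type, and a finite subset of \<open>J\<close> is linearly ordered by
  restriction; inclusions then preserve the order automatically, and any two members of
  \<open>FinLO J\<close> have an upper bound. (If the same finite set were allowed to carry several orders,
  related by order-preserving inclusions only, upper bounds would not exist and the composition
  of finite approximation families would depend on the intermediate index.)\<close>

definition FinLO :: "'j::linorder set \<Rightarrow> 'j set set" where
  "FinLO J = {F. finite F \<and> F \<subseteq> J}"

text \<open>An abstract infinite tensor product is given by its family \<open>X :: 'j \<rightharpoonup> 'o\<close> of factors, with
  index set \<open>J\<^sub>X = dom X\<close>. The functor on \<open>(FinLO J\<^sub>X)\<^sup>o\<^sup>p\<close> that it stands for consists of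
  \<open>tensor_over C X F\<close> on objects and \<open>proj C X F' F\<close> on morphisms.\<close>

definition tensor_list ::
  "('o, 'm, 'z) tensor_cat_scheme \<Rightarrow> ('j \<rightharpoonup> 'o) \<Rightarrow> 'j list \<Rightarrow> 'o" where
  "tensor_list C X js = foldr (\<lambda>j. TenO C (the (X j))) js (Unit C)"

definition tensor_over ::
  "('o, 'm, 'z) tensor_cat_scheme \<Rightarrow> ('j::linorder \<rightharpoonup> 'o) \<Rightarrow> 'j set \<Rightarrow> 'o" where
  "tensor_over C X F = tensor_list C X (sorted_list_of_set F)"

text \<open>Keep the factors with index in \<open>F\<close>, delete the others.\<close>

primrec proj_list ::
  "('o, 'm, 'z) tensor_cat_scheme \<Rightarrow> ('j \<rightharpoonup> 'o) \<Rightarrow> 'j set \<Rightarrow> 'j list \<Rightarrow> 'm" where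
  "proj_list C X F [] = Idn C (Unit C)"
| "proj_list C X F (j # js) =
     (if j \<in> F then TenM C (Idn C (the (X j))) (proj_list C X F js)
      else Comp C (LUnit C (tensor_list C X (filter (\<lambda>i. i \<in> F) js)))
             (TenM C (del C (the (X j))) (proj_list C X F js)))"

definition proj ::
  "('o, 'm, 'z) tensor_cat_scheme \<Rightarrow> ('j::linorder \<rightharpoonup> 'o) \<Rightarrow> 'j set \<Rightarrow> 'j set \<Rightarrow> 'm" where
  "proj C X F' F = proj_list C X F (sorted_list_of_set F')"

text \<open>A family \<open>(f\<^sub>F\<^sub>,\<^sub>G)\<close> indexed by \<open>(F, G) \<in> \<Lambda>\<^sub>f\<close> is a partial map with domain \<open>\<Lambda>\<^sub>f = dom f\<close>.\<close>

type_synonym ('j, 'm) family = "'j set \<times> 'j set \<rightharpoonup> 'm"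

definition finite_approximation_family ::
  "('o, 'm, 'z) tensor_cat_scheme \<Rightarrow> ('j::linorder \<rightharpoonup> 'o) \<Rightarrow> ('j \<rightharpoonup> 'o) \<Rightarrow>
   ('j, 'm) family \<Rightarrow> bool" where
  "finite_approximation_family C X Y f \<longleftrightarrow>
     dom f \<subseteq> FinLO (dom X) \<times> FinLO (dom Y) \<and>
     (\<forall>F G. (F, G) \<in> dom f \<longrightarrow> the (f (F, G)) \<in> hom C (tensor_over C X F) (tensor_over C Y G)) \<and>
     \<comment> \<open>Naturality\<close>
     (\<forall>F G F' G'. (F, G) \<in> dom f \<and> (F', G') \<in> dom f \<and> F \<subseteq> F' \<and> G \<subseteq> G' \<longrightarrow>
        Comp C (proj C Y G' G) (the (f (F', G'))) = Comp C (the (f (F, G))) (proj C X F' F)) \<and>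
     \<comment> \<open>Covering\<close>
     (\<forall>G \<in> FinLO (dom Y). \<exists>F. (F, G) \<in> dom f) \<and>
     \<comment> \<open>Hereditariness\<close>
     (\<forall>F G. (F, G) \<in> dom f \<longrightarrow> (\<forall>F' \<in> FinLO (dom X). F \<subseteq> F' \<longrightarrow> (F', G) \<in> dom f))"

definition family_equiv ::
  "('o, 'm, 'z) tensor_cat_scheme \<Rightarrow> ('j::linorder \<rightharpoonup> 'o) \<Rightarrow> ('j \<rightharpoonup> 'o) \<Rightarrow>
   (('j, 'm) family \<times> ('j, 'm) family) set" where
  "family_equiv C X Y = {(f, f').
     finite_approximation_family C X Y f \<and> finite_approximation_family C X Y f' \<and>
     (\<forall>p \<in> dom f \<inter> dom f'. f p = f' p)}"

text \<open>The description operator expresses that the value does not depend on \<open>G\<close>.\<close>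

definition family_comp ::
  "('o, 'm, 'z) tensor_cat_scheme \<Rightarrow> ('j, 'm) family \<Rightarrow> ('j, 'm) family \<Rightarrow> ('j, 'm) family" where
  "family_comp C g f = (\<lambda>(F, H).
     if \<exists>G. (F, G) \<in> dom f \<and> (G, H) \<in> dom g
     then Some (THE m. \<exists>G. (F, G) \<in> dom f \<and> (G, H) \<in> dom g \<and>
                  m = Comp C (the (g (G, H))) (the (f (F, G))))
     else None)"

definition family_id ::
  "('o, 'm, 'z) tensor_cat_scheme \<Rightarrow> ('j::linorder \<rightharpoonup> 'o) \<Rightarrow> ('j, 'm) family" where
  "family_id C X = (\<lambda>(F, G).
     if F \<in> FinLO (dom X) \<and> G \<subseteq> F then Some (proj C X F G) else None)"

definition expl ::
  "('o, 'm, 'z) tensor_cat_scheme \<Rightarrow> 'j::linorder \<Rightarrow>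
   ('j \<rightharpoonup> 'o, ('j \<rightharpoonup> 'o, ('j, 'm) family set) arr) cat" where
  "expl C star =
     (let ob = {X. ran X \<subseteq> Obj C \<and> countable (dom X) \<and> star \<in> dom X} in
      \<lparr>Obj = ob,
       Mor = {u. src u \<in> ob \<and> tgt u \<in> ob \<and>
                 act u \<in> {f. finite_approximation_family C (src u) (tgt u) f} //
                           family_equiv C (src u) (tgt u)},
       Dom = src,
       Cod = tgt,
       Idn = (\<lambda>X. Arr X X (family_equiv C X X `` {family_id C X})),
       Comp = (\<lambda>v u. Arr (src u) (tgt v)
         (\<Union>f \<in> act u. \<Union>g \<in> act v. family_equiv C (src u) (tgt v) `` {family_comp C g f}))\<rparr>)"


section \<open>Locally constant Markov kernels between Stone spaces\<close>

definition Clopen :: "'a topology \<Rightarrow> 'a set set" where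
  "Clopen X = {U. openin X U \<and> closedin X U}"

definition Stone_space :: "'a topology \<Rightarrow> bool" where
  "Stone_space X \<longleftrightarrow> compact_space X \<and> Hausdorff_space X \<and>
     (\<forall>W x. openin X W \<and> x \<in> W \<longrightarrow> (\<exists>U \<in> Clopen X. x \<in> U \<and> U \<subseteq> W))"

definition locally_constant :: "'a topology \<Rightarrow> ('a \<Rightarrow> 'b) \<Rightarrow> bool" where
  "locally_constant X h \<longleftrightarrow>
     (\<forall>x \<in> topspace X. \<exists>V. openin X V \<and> x \<in> V \<and> (\<forall>x' \<in> V. h x' = h x))"

definition fin_add_prob :: "'a topology \<Rightarrow> ('a set \<Rightarrow> real) \<Rightarrow> bool" where
  "fin_add_prob Y m \<longleftrightarrow>
     (\<forall>U \<in> Clopen Y. 0 \<le> m U) \<and> m (topspace Y) = 1 \<and>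
     (\<forall>U \<in> Clopen Y. \<forall>V \<in> Clopen Y. U \<inter> V = {} \<longrightarrow> m (U \<union> V) = m U + m V)"

text \<open>\<open>k U x\<close> stands for \<open>k(U | x)\<close>. The last conjunct fixes the value outside
  \<open>Clopen Y \<times> topspace X\<close>, so that equality of HOL functions is equality of kernels.\<close>

definition lc_kernel :: "'a topology \<Rightarrow> 'a topology \<Rightarrow> ('a set \<Rightarrow> 'a \<Rightarrow> real) \<Rightarrow> bool" where
  "lc_kernel X Y k \<longleftrightarrow>
     (\<forall>U \<in> Clopen Y. \<forall>x \<in> topspace X. k U x \<in> {0..1}) \<and>
     (\<forall>U \<in> Clopen Y. locally_constant X (k U)) \<and>
     (\<forall>x \<in> topspace X. fin_add_prob Y (\<lambda>U. k U x)) \<and>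
     (\<forall>U x. \<not> (U \<in> Clopen Y \<and> x \<in> topspace X) \<longrightarrow> k U x = 0)"

definition adapted_partition :: "'a topology \<Rightarrow> ('a \<Rightarrow> real) \<Rightarrow> 'a set set \<Rightarrow> bool" where
  "adapted_partition Y h P \<longleftrightarrow>
     finite P \<and> partition_on (topspace Y) P \<and> P \<subseteq> Clopen Y \<and>
     (\<forall>U \<in> P. \<forall>y \<in> U. \<forall>y' \<in> U. h y = h y')"

text \<open>The integral of a locally constant \<open>h\<close>: the common value of the sums over all adapted
  partitions.\<close>

definition lc_integral :: "'a topology \<Rightarrow> ('a \<Rightarrow> real) \<Rightarrow> ('a set \<Rightarrow> real) \<Rightarrow> real" where
  "lc_integral Y h m = (THE s. \<exists>P. adapted_partition Y h P \<and>
     s = (\<Sum>U \<in> P. h (SOME y. y \<in> U) * m U))"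

definition StoneStoch_lc ::
  "('a topology, ('a topology, 'a set \<Rightarrow> 'a \<Rightarrow> real) arr) cat" where
  "StoneStoch_lc = \<lparr>
     Obj = {X. Stone_space X},
     Mor = {f. Stone_space (src f) \<and> Stone_space (tgt f) \<and> lc_kernel (src f) (tgt f) (act f)},
     Dom = src,
     Cod = tgt,
     Idn = (\<lambda>X. Arr X X (\<lambda>U x. if U \<in> Clopen X \<and> x \<in> U then 1 else 0)),
     Comp = (\<lambda>g f. Arr (src f) (tgt g)
       (\<lambda>V x. if V \<in> Clopen (tgt g) \<and> x \<in> topspace (src f)
              then lc_integral (tgt f) (act g V) (\<lambda>U. act f U x) else 0))\<rparr>"

text \<open>The space \<open>2\<^sup>N\<close>, where \<open>N\<close> is given as a set of coordinates: \<open>{..<n}\<close> for a natural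
  number \<open>n\<close>, or \<open>UNIV\<close> for the Cantor space. Its points are the functions on \<open>N\<close>
  (extended by \<open>undefined\<close>).\<close>

definition two_pow :: "nat set \<Rightarrow> (nat \<Rightarrow> bool) topology" where
  "two_pow N = product_topology (\<lambda>_. discrete_topology (UNIV :: bool set)) N"

definition CantorStoch_lc ::
  "((nat \<Rightarrow> bool) topology,
    ((nat \<Rightarrow> bool) topology, (nat \<Rightarrow> bool) set \<Rightarrow> (nat \<Rightarrow> bool) \<Rightarrow> real) arr) cat" where
  "CantorStoch_lc =
     full_subcategory StoneStoch_lc (insert (two_pow UNIV) (range (\<lambda>n. two_pow {..<n})))"

end

theory Submission
  imports Defs
begin

text \<open>An infinite tensor product \<open>X\<close> of powers \<open>2\<^sup>n\<close> is remembered by its bits: pairs \<open>(j, i)\<close> of a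
  factor \<open>j\<close> and a position \<open>i < X\<^sub>j\<close>. Numbering the countably many bits sends \<open>X\<close> to the space
  \<open>2\<^sup>N\<close> of all bit assignments, where \<open>N\<close> is the number of bits, and \<open>X\<^sub>F\<close> becomes the finite quotient
  of \<open>2\<^sup>N\<close> that records the bits of the factors in \<open>F\<close>; write \<open>observe X F\<close> for the quotient map.
  The projections \<open>\<pi>\<^sub>F\<^sub>'\<^sub>,\<^sub>F\<close> are exactly the maps that turn the observation of \<open>F'\<close> into that of \<open>F\<close>.

  By compactness every clopen subset of \<open>2\<^sup>N\<close>, and more generally every locally constant function on
  it, factors through one of these quotients. A locally constant kernel \<open>k\<close> from \<open>X\<close> to \<open>Y\<close> is
  therefore determined by the numbers \<open>k({observe Y G = y} | x)\<close>, and each of these depends on \<open>x\<close>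
  through some \<open>observe X F\<close> only. A finite approximation family \<open>represents\<close> \<open>k\<close> if its matrices list
  these numbers, that is, if \<open>f\<^sub>F\<^sub>,\<^sub>G(y | observe X F x) = k({observe Y G = y} | x)\<close>. Finite
  additivity of \<open>k\<close> corresponds to naturality of the family in \<open>G\<close>, local constancy to covering.
  Every family represents exactly one kernel (\<open>lc_kernel_family_kernel\<close>,
  \<open>represents_family_kernel\<close>, \<open>family_kernel_unique\<close>), every kernel is represented
  (\<open>kernel_represented\<close>), and two families are equivalent if and only if they represent the same
  kernel (\<open>family_equiv_iff\<close>). The composite of families represents the composite of kernels,
  because summing over the words of an intermediate \<open>Y\<^sub>G\<close> is integrating over the partition of the
  middle space into the fibres of \<open>observe Y G\<close> (\<open>family_family_comp\<close>).

  So classes of families are in functorial bijection with kernels. On objects all spaces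
  \<open>2\<^sup>n\<close> and \<open>2\<^sup>\<nat>\<close> are reached (\<open>cantor_surj\<close>), and a fully faithful functor that is
  surjective on objects is an equivalence. The same bijection carries the category laws
  from kernels, where they are identities between finite sums, over to families.\<close>

section \<open>Equivalences of categories\<close>

text \<open>Since \<open>Fm\<close> is injective on every hom-set and respects identities and composition, the unit and
  associativity laws of \<open>C\<close> can be checked in \<open>D\<close>; hence only the typing of its operations is assumed.
  With a section \<open>Go\<close> of \<open>Fo\<close> the counit of the equivalence is the identity, and the unit at \<open>A\<close> is
  the unique morphism that \<open>Fm\<close> sends to the identity of \<open>Fo A = Fo (Go (Fo A))\<close>.\<close>

lemma equivalent_categories_if_surj_fully_faithful:
  fixes C :: "('o1, 'm1, 'z1) cat_scheme" and D :: "('o2, 'm2, 'z2) cat_scheme"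
  assumes D: "category D"
    and Dom: "\<And>f. f \<in> Mor C \<Longrightarrow> Dom C f \<in> Obj C"
    and Cod: "\<And>f. f \<in> Mor C \<Longrightarrow> Cod C f \<in> Obj C"
    and Idn: "\<And>A. A \<in> Obj C \<Longrightarrow> Idn C A \<in> hom C A A"
    and Comp: "\<And>A B E f g. f \<in> hom C A B \<Longrightarrow> g \<in> hom C B E \<Longrightarrow> Comp C g f \<in> hom C A E"
    and surj: "Fo ` Obj C = Obj D"
    and bij: "\<And>A B. A \<in> Obj C \<Longrightarrow> B \<in> Obj C \<Longrightarrow> bij_betw Fm (hom C A B) (hom D (Fo A) (Fo B))"
    and F_Idn: "\<And>A. A \<in> Obj C \<Longrightarrow> Fm (Idn C A) = Idn D (Fo A)"
    and F_Comp: "\<And>A B E f g. f \<in> hom C A B \<Longrightarrow> g \<in> hom C B E \<Longrightarrow>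
      Fm (Comp C g f) = Comp D (Fm g) (Fm f)"
  shows "equivalent_categories C D"
proof -
  interpret D: category D by (rule D)
  have hom_Obj: "A \<in> Obj C" "B \<in> Obj C" if "f \<in> hom C A B" for f A B
    using that Dom Cod unfolding hom_def by auto
  have homD_Obj: "A \<in> Obj D" "B \<in> Obj D" if "f \<in> hom D A B" for f A B
    using that D.Dom_Obj D.Cod_Obj unfolding hom_def by auto
  have F_hom: "Fm f \<in> hom D (Fo A) (Fo B)" if "f \<in> hom C A B" for f A B
    using bij[OF hom_Obj[OF that]] that by (auto simp: bij_betw_def)
  have eqI: "f = g" if "f \<in> hom C A B" "g \<in> hom C A B" "Fm f = Fm g" for f g A B
    using bij[OF hom_Obj[OF that(1)]] that by (auto simp: bij_betw_def inj_on_def)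
  have C: "category C"
  proof
    fix f g h A B E K assume f: "f \<in> hom C A B" and g: "g \<in> hom C B E" and h: "h \<in> hom C E K"
    show "Comp C h (Comp C g f) = Comp C (Comp C h g) f"
    proof (rule eqI)
      show "Comp C h (Comp C g f) \<in> hom C A K" "Comp C (Comp C h g) f \<in> hom C A K"
        using f g h Comp by blast+
      show "Fm (Comp C h (Comp C g f)) = Fm (Comp C (Comp C h g) f)"
        using F_Comp[OF f g] F_Comp[OF g h] F_Comp[OF Comp[OF f g] h] F_Comp[OF f Comp[OF g h]]
          D.Comp_assoc[OF F_hom[OF f] F_hom[OF g] F_hom[OF h]] by simp
    qed
  next
    fix f A B assume f: "f \<in> hom C A B"
    note AB = hom_Obj[OF f]
    show "Comp C (Idn C B) f = f"
      by (rule eqI[OF Comp[OF f Idn[OF AB(2)]] f])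
        (simp add: F_Comp[OF f Idn[OF AB(2)]] F_Idn AB D.Comp_Idn_left[OF F_hom[OF f]])
    show "Comp C f (Idn C A) = f"
      by (rule eqI[OF Comp[OF Idn[OF AB(1)] f] f])
        (simp add: F_Comp[OF Idn[OF AB(1)] f] F_Idn AB D.Comp_Idn_right[OF F_hom[OF f]])
  qed (use Dom Cod Idn Comp in auto)
  interpret C: category C by (rule C)
  define L where "L A B = inv_into (hom C A B) Fm" for A B
  have L_hom: "L A B g \<in> hom C A B" and F_L: "Fm (L A B g) = g"
    if "A \<in> Obj C" "B \<in> Obj C" "g \<in> hom D (Fo A) (Fo B)" for A B g
    using bij[OF that(1,2)] that(3) unfolding L_def bij_betw_def
    by (auto intro: inv_into_into f_inv_into_f)
  define Go where "Go = inv_into (Obj C) Fo"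
  have Go: "Go Y \<in> Obj C" "Fo (Go Y) = Y" if "Y \<in> Obj D" for Y
    using that surj unfolding Go_def by (auto intro: inv_into_into f_inv_into_f)
  have Fo: "Fo A \<in> Obj D" if "A \<in> Obj C" for A
    using that surj by auto
  define Gm where "Gm g = L (Go (Dom D g)) (Go (Cod D g)) g" for g
  have Gm_eq: "Gm g = L (Go Y) (Go Z) g" if "g \<in> hom D Y Z" for g Y Z
    using that unfolding Gm_def hom_def by auto
  have Gm_hom: "Gm g \<in> hom C (Go Y) (Go Z)" and F_Gm: "Fm (Gm g) = g"
    if g: "g \<in> hom D Y Z" for g Y Z
  proof -
    have "g \<in> hom D (Fo (Go Y)) (Fo (Go Z))"
      using g Go homD_Obj[OF g] by simp
    then show "Gm g \<in> hom C (Go Y) (Go Z)" "Fm (Gm g) = g"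
      unfolding Gm_eq[OF g] using L_hom F_L Go homD_Obj[OF g] by auto
  qed
  have cF: "cat_functor C D Fo Fm"
    by unfold_locales (use Fo F_hom F_Idn F_Comp in auto)
  have G_Idn: "Gm (Idn D Y) = Idn C (Go Y)" if "Y \<in> Obj D" for Y
    by (rule eqI[OF Gm_hom[OF D.Idn_hom[OF that]] Idn[OF Go(1)[OF that]]])
      (simp add: F_Gm[OF D.Idn_hom[OF that]] F_Idn Go that)
  have G_Comp: "Gm (Comp D g f) = Comp C (Gm g) (Gm f)"
    if f: "f \<in> hom D A B" and g: "g \<in> hom D B E" for f g A B E
    by (rule eqI[OF Gm_hom[OF D.Comp_hom[OF f g]] Comp[OF Gm_hom[OF f] Gm_hom[OF g]]])
      (simp add: F_Gm[OF D.Comp_hom[OF f g]] F_Comp[OF Gm_hom[OF f] Gm_hom[OF g]]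
        F_Gm[OF f] F_Gm[OF g])
  have cG: "cat_functor D C Go Gm"
    by unfold_locales (use Go Gm_hom G_Idn G_Comp in auto)
  have idC: "cat_functor C C id id" and idD: "cat_functor D D id id"
    by unfold_locales auto
  have cGF: "cat_functor C C (Go \<circ> Fo) (Gm \<circ> Fm)"
    by unfold_locales (use Fo Go F_hom Gm_hom G_Idn F_Idn G_Comp F_Comp in \<open>auto, metis+\<close>)
  have cFG: "cat_functor D D (Fo \<circ> Go) (Fm \<circ> Gm)"
    by unfold_locales (use Fo Go F_hom Gm_hom G_Idn F_Idn G_Comp F_Comp in \<open>auto, metis+\<close>)
  define s where "s A = L A (Go (Fo A)) (Idn D (Fo A))" for A
  have s_pre: "Idn D (Fo A) \<in> hom D (Fo A) (Fo (Go (Fo A)))"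
    "Idn D (Fo A) \<in> hom D (Fo (Go (Fo A))) (Fo A)" if "A \<in> Obj C" for A
    using D.Idn_hom[OF Fo[OF that]] Go(2)[OF Fo[OF that]] by simp_all
  have s_hom: "s A \<in> hom C A (Go (Fo A))" and F_s: "Fm (s A) = Idn D (Fo A)"
    if "A \<in> Obj C" for A
    unfolding s_def using L_hom[OF that Go(1)[OF Fo[OF that]] s_pre(1)[OF that]]
      F_L[OF that Go(1)[OF Fo[OF that]] s_pre(1)[OF that]] by auto
  have s_iso: "isomorphism C A (Go (Fo A)) (s A)" if A: "A \<in> Obj C" for A
  proof -
    define r where "r = L (Go (Fo A)) A (Idn D (Fo A))"
    have r_hom: "r \<in> hom C (Go (Fo A)) A" and F_r: "Fm r = Idn D (Fo A)"
      unfolding r_def using L_hom[OF Go(1)[OF Fo[OF A]] A s_pre(2)[OF A]]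
        F_L[OF Go(1)[OF Fo[OF A]] A s_pre(2)[OF A]] by auto
    have II: "Comp D (Idn D (Fo A)) (Idn D (Fo A)) = Idn D (Fo A)"
      using D.Comp_Idn_left[OF D.Idn_hom[OF Fo[OF A]]] .
    have "Comp C r (s A) = Idn C A"
      by (rule eqI[OF Comp[OF s_hom[OF A] r_hom] Idn[OF A]])
        (simp add: F_Comp[OF s_hom[OF A] r_hom] F_s F_r A II F_Idn)
    moreover have "Comp C (s A) r = Idn C (Go (Fo A))"
      by (rule eqI[OF Comp[OF r_hom s_hom[OF A]] Idn[OF Go(1)[OF Fo[OF A]]]])
        (simp add: F_Comp[OF r_hom s_hom[OF A]] F_s F_r A II F_Idn Go Fo)
    ultimately show ?thesis
      unfolding isomorphism_def using s_hom[OF A] r_hom by blast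
  qed
  have s_nat: "Comp C (s B) f = Comp C (Gm (Fm f)) (s A)" if f: "f \<in> hom C A B" for A B f
  proof -
    note AB = hom_Obj[OF f] and Ff = F_hom[OF f]
    show ?thesis
      by (rule eqI[OF Comp[OF f s_hom[OF AB(2)]] Comp[OF s_hom[OF AB(1)] Gm_hom[OF Ff]]])
        (simp add: F_Comp[OF f s_hom[OF AB(2)]] F_Comp[OF s_hom[OF AB(1)] Gm_hom[OF Ff]]
          F_s AB F_Gm[OF Ff] D.Comp_Idn_left[OF Ff] D.Comp_Idn_right[OF Ff])
  qed
  have nat_s: "natural_isomorphism C C id id (Go \<circ> Fo) (Gm \<circ> Fm) s"
    unfolding natural_isomorphism_def using idC cGF s_iso s_nat by auto
  have t_iso: "isomorphism D Y Y (Idn D Y)" if "Y \<in> Obj D" for Y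
    unfolding isomorphism_def using D.Idn_hom[OF that] D.Comp_Idn_left by blast
  have nat_t: "natural_isomorphism D D (Fo \<circ> Go) (Fm \<circ> Gm) id id (Idn D)"
    unfolding natural_isomorphism_def
    using idD cFG t_iso Go F_Gm D.Comp_Idn_left D.Comp_Idn_right by auto
  show ?thesis
    unfolding equivalent_categories_def using C D cF cG nat_s nat_t by blast
qed

lemma category_full_subcategory:
  fixes C :: "('o, 'm) cat"
  assumes "category C"
  shows "category (full_subcategory C S)"
proof -
  interpret category C by (rule assms)
  have hom: "f \<in> hom (full_subcategory C S) A B \<longleftrightarrow> f \<in> hom C A B \<and> A \<in> S \<and> B \<in> S" for f A B
    unfolding hom_def full_subcategory_def by auto
  have Comp: "Comp (full_subcategory C S) = Comp C" and Idn: "Idn (full_subcategory C S) = Idn C"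
    unfolding full_subcategory_def by auto
  show ?thesis
    by unfold_locales
      (auto simp: hom Comp Idn Comp_hom Comp_assoc Comp_Idn_left Comp_Idn_right Idn_hom,
       auto simp: full_subcategory_def Dom_Obj Cod_Obj Idn_hom)
qed

section \<open>Locally constant functions and Markov kernels\<close>

lemma locally_constant_map:
  assumes "locally_constant X h" "\<And>x x'. x \<in> topspace X \<Longrightarrow> x' \<in> topspace X \<Longrightarrow> h x = h x' \<Longrightarrow> h' x = h' x'"
  shows "locally_constant X h'"
  unfolding locally_constant_def
proof
  fix x assume x: "x \<in> topspace X"
  then obtain V where V: "openin X V" "x \<in> V" "\<forall>x'\<in>V. h x' = h x"
    using assms(1) unfolding locally_constant_def by blast
  moreover have "\<forall>x'\<in>V. h' x' = h' x"
    using V assms(2) x openin_subset[OF V(1)] by blast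
  ultimately show "\<exists>V. openin X V \<and> x \<in> V \<and> (\<forall>x'\<in>V. h' x' = h' x)" by blast
qed

lemma locally_constant_Pair:
  assumes "locally_constant X h" "locally_constant X h'"
  shows "locally_constant X (\<lambda>x. (h x, h' x))"
  unfolding locally_constant_def
proof
  fix x assume x: "x \<in> topspace X"
  obtain V where V: "openin X V" "x \<in> V" "\<forall>x'\<in>V. h x' = h x"
    using assms(1) x unfolding locally_constant_def by blast
  obtain W where W: "openin X W" "x \<in> W" "\<forall>x'\<in>W. h' x' = h' x"
    using assms(2) x unfolding locally_constant_def by blast
  have "\<forall>x'\<in>V \<inter> W. (h x', h' x') = (h x, h' x)"
    using V(3) W(3) by (metis IntE)
  then show "\<exists>V. openin X V \<and> x \<in> V \<and> (\<forall>x'\<in>V. (h x', h' x') = (h x, h' x))"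
    using V(1,2) W(1,2) openin_Int by blast
qed

text \<open>Bundling finitely many locally constant functions into one replaces a common
  refinement of finitely many clopen partitions: the fibres of the bundle refine all of them.\<close>

lemma locally_constant_family:
  assumes "finite I" "\<And>i. i \<in> I \<Longrightarrow> locally_constant X (h i)"
  shows "locally_constant X (\<lambda>x. \<lambda>i\<in>I. h i x)"
  using assms
proof (induction I rule: finite_induct)
  case empty
  show ?case unfolding locally_constant_def
    by (intro ballI exI[of _ "topspace X"]) (simp add: restrict_def)
next
  case (insert j I)
  have "locally_constant X (\<lambda>x. \<lambda>i\<in>I. h i x)"
    by (rule insert.IH) (rule insert.prems, simp)
  moreover have "locally_constant X (h j)"
    by (rule insert.prems) simp
  ultimately have "locally_constant X (\<lambda>x. (h j x, \<lambda>i\<in>I. h i x))"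
    by (intro locally_constant_Pair)
  then show ?case
  proof (rule locally_constant_map)
    fix x x' assume eq: "(h j x, \<lambda>i\<in>I. h i x) = (h j x', \<lambda>i\<in>I. h i x')"
    show "(\<lambda>i\<in>insert j I. h i x) = (\<lambda>i\<in>insert j I. h i x')"
    proof (rule restrict_ext)
      fix i assume "i \<in> insert j I"
      moreover have "(\<lambda>i\<in>I. h i x) i = (\<lambda>i\<in>I. h i x') i" "h j x = h j x'"
        using eq by simp_all
      ultimately show "h i x = h i x'"
        by (cases "i = j") simp_all
    qed
  qed
qed

lemma Clopen_subset: "U \<in> Clopen X \<Longrightarrow> U \<subseteq> topspace X"
  unfolding Clopen_def by (auto dest: openin_subset)

lemma Clopen_topspace: "topspace X \<in> Clopen X" and Clopen_empty: "{} \<in> Clopen X"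
  unfolding Clopen_def by auto

lemma Clopen_Un: "U \<in> Clopen X \<Longrightarrow> V \<in> Clopen X \<Longrightarrow> U \<union> V \<in> Clopen X"
  unfolding Clopen_def by auto

lemma Clopen_Diff: "U \<in> Clopen X \<Longrightarrow> topspace X - U \<in> Clopen X"
  unfolding Clopen_def by auto

lemma Clopen_Collect:
  assumes "locally_constant X h"
  shows "{x \<in> topspace X. P (h x)} \<in> Clopen X"
proof -
  have op: "openin X {x \<in> topspace X. Q (h x)}" for Q
  proof (subst openin_subopen, intro ballI)
    fix x assume x: "x \<in> {x \<in> topspace X. Q (h x)}"
    then obtain V where V: "openin X V" "x \<in> V" "\<forall>x'\<in>V. h x' = h x"
      using assms unfolding locally_constant_def by blast
    have "Q (h x')" if "x' \<in> V" for x'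
      using V(3)[rule_format, OF that] x by simp
    then show "\<exists>V. openin X V \<and> x \<in> V \<and> V \<subseteq> {x \<in> topspace X. Q (h x)}"
      using V(1,2) openin_subset[OF V(1)] by blast
  qed
  have "topspace X - {x \<in> topspace X. P (h x)} = {x \<in> topspace X. \<not> P (h x)}" by auto
  then show ?thesis
    unfolding Clopen_def using op[of P] op[of "\<lambda>c. \<not> P c"] by (auto simp: closedin_def)
qed

lemma Clopen_fibre:
  "locally_constant X h \<Longrightarrow> {x \<in> topspace X. h x = c} \<in> Clopen X"
  by (rule Clopen_Collect)

lemma locally_constant_Clopen:
  assumes "U \<in> Clopen X"
  shows "locally_constant X (\<lambda>x. x \<in> U)"
  unfolding locally_constant_def
proof
  fix x assume "x \<in> topspace X"
  moreover have "openin X U" "openin X (topspace X - U)"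
    using assms unfolding Clopen_def by (auto simp: closedin_def)
  ultimately show "\<exists>V. openin X V \<and> x \<in> V \<and> (\<forall>x'\<in>V. (x' \<in> U) = (x \<in> U))"
    by (cases "x \<in> U") blast+
qed

lemma finite_image_locally_constant:
  assumes "compact_space X" "locally_constant X h"
  shows "finite (h ` topspace X)"
proof -
  define F where "F c = {x \<in> topspace X. h x = c}" for c
  have "openin X U" if "U \<in> F ` h ` topspace X" for U
    using that Clopen_fibre[OF assms(2)] unfolding F_def Clopen_def by auto
  moreover have "topspace X \<subseteq> \<Union> (F ` h ` topspace X)"
    unfolding F_def by auto
  ultimately obtain \<F> where \<F>: "finite \<F>" "\<F> \<subseteq> F ` h ` topspace X" "topspace X \<subseteq> \<Union>\<F>"
    using assms(1) unfolding compact_space_alt by (metis (no_types, lifting))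
  then obtain I where I: "finite I" "I \<subseteq> h ` topspace X" "\<F> = F ` I"
    by (meson finite_subset_image)
  have "h ` topspace X \<subseteq> I"
    using \<F>(3) unfolding I(3) F_def by auto
  then show ?thesis using I(1) finite_subset by blast
qed

subsection \<open>Finitely additive probability measures\<close>

lemma fin_add_prob_empty:
  assumes "fin_add_prob Y m" shows "m {} = 0"
  using assms Clopen_empty[of Y] unfolding fin_add_prob_def by fastforce

lemma fin_add_prob_nonneg: "fin_add_prob Y m \<Longrightarrow> U \<in> Clopen Y \<Longrightarrow> 0 \<le> m U"
  and fin_add_prob_topspace: "fin_add_prob Y m \<Longrightarrow> m (topspace Y) = 1"
  and fin_add_prob_Un: "fin_add_prob Y m \<Longrightarrow> U \<in> Clopen Y \<Longrightarrow> V \<in> Clopen Y \<Longrightarrow> U \<inter> V = {} \<Longrightarrow>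
    m (U \<union> V) = m U + m V"
  unfolding fin_add_prob_def by auto

lemma fin_add_prob_nonempty:
  assumes "fin_add_prob Y m" shows "topspace Y \<noteq> {}"
  using fin_add_prob_empty[OF assms] assms unfolding fin_add_prob_def by force

lemma fin_add_prob_le_1:
  assumes "fin_add_prob Y m" "U \<in> Clopen Y" shows "m U \<le> 1"
proof -
  have "U \<union> (topspace Y - U) = topspace Y"
    using Clopen_subset[OF assms(2)] by auto
  then have "1 = m U + m (topspace Y - U)" "0 \<le> m (topspace Y - U)"
    using assms Clopen_Diff[OF assms(2)] unfolding fin_add_prob_def by (metis Diff_disjoint)+
  then show ?thesis by simp
qed

lemma fin_add_prob_UN:
  assumes m: "fin_add_prob Y m" and "finite I" "\<And>i. i \<in> I \<Longrightarrow> U i \<in> Clopen Y"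
    and "disjoint_family_on U I"
  shows "(\<Union>i\<in>I. U i) \<in> Clopen Y \<and> m (\<Union>i\<in>I. U i) = (\<Sum>i\<in>I. m (U i))"
  using assms(2-4)
proof (induction I rule: finite_induct)
  case empty
  then show ?case using fin_add_prob_empty[OF m] Clopen_empty by auto
next
  case (insert j I)
  have IH: "(\<Union>i\<in>I. U i) \<in> Clopen Y" "m (\<Union>i\<in>I. U i) = (\<Sum>i\<in>I. m (U i))"
    using insert by (auto simp: disjoint_family_on_def)
  moreover have "U j \<inter> (\<Union>i\<in>I. U i) = {}"
    using insert.prems(2) insert.hyps(2) by (auto simp: disjoint_family_on_def)
  ultimately show ?case
    using insert m Clopen_Un[of "U j" Y "\<Union>i\<in>I. U i"] unfolding fin_add_prob_def by auto
qed

lemma fin_add_prob_sum_fibres: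
  assumes m: "fin_add_prob Y m" and q: "locally_constant Y q" and "finite S"
  shows "m {y \<in> topspace Y. q y \<in> S} = (\<Sum>c\<in>S. m {y \<in> topspace Y. q y = c})"
proof -
  have "{y \<in> topspace Y. q y \<in> S} = (\<Union>c\<in>S. {y \<in> topspace Y. q y = c})" by auto
  moreover have "disjoint_family_on (\<lambda>c. {y \<in> topspace Y. q y = c}) S"
    by (auto simp: disjoint_family_on_def)
  ultimately show ?thesis
    using fin_add_prob_UN[OF m assms(3) Clopen_fibre[OF q]] by simp
qed

subsection \<open>The integral of a locally constant function\<close>

text \<open>Members of \<open>P\<close> on which \<open>h\<close> has the same value merge into one level set of \<open>h\<close>. As the
  right-hand side does not mention \<open>P\<close>, the integral is well defined.\<close>

lemma sum_adapted_partition: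
  assumes m: "fin_add_prob Y m" and P: "adapted_partition Y h P"
  shows "(\<Sum>U\<in>P. h (SOME y. y \<in> U) * m U) =
    (\<Sum>c\<in>h ` topspace Y. c * m {y \<in> topspace Y. h y = c})"
proof -
  let ?v = "\<lambda>U. h (SOME y. y \<in> U)"
  have fin: "finite P" and UP: "\<Union>P = topspace Y" and ne: "{} \<notin> P" and disj: "disjoint P"
    and cl: "P \<subseteq> Clopen Y" and const: "\<And>U y y'. U \<in> P \<Longrightarrow> y \<in> U \<Longrightarrow> y' \<in> U \<Longrightarrow> h y = h y'"
    using P unfolding adapted_partition_def partition_on_def by blast+
  have v: "?v U = h y" if "U \<in> P" "y \<in> U" for U y
    using const[OF that(1) someI[of "\<lambda>y. y \<in> U", OF that(2)] that(2)] .
  have im: "?v ` P = h ` topspace Y"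
  proof (intro equalityI subsetI)
    fix c assume "c \<in> ?v ` P"
    then obtain U where U: "U \<in> P" "c = ?v U" by auto
    then obtain y where "y \<in> U" using ne by (metis ex_in_conv)
    then show "c \<in> h ` topspace Y" using U v UP by auto
  next
    fix c assume "c \<in> h ` topspace Y"
    then obtain y U where "c = h y" "y \<in> U" "U \<in> P" using UP by blast
    then have "c = ?v U" using v by simp
    then show "c \<in> ?v ` P" using \<open>U \<in> P\<close> by (rule image_eqI)
  qed
  have level: "(\<Sum>U\<in>{U\<in>P. ?v U = c}. ?v U * m U) = c * m {y \<in> topspace Y. h y = c}" for c
  proof -
    have "(\<Union>U\<in>{U\<in>P. ?v U = c}. U) = {y \<in> topspace Y. h y = c}"
    proof (intro equalityI subsetI)
      fix y assume "y \<in> {y \<in> topspace Y. h y = c}"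
      moreover from this obtain U where "y \<in> U" "U \<in> P" using UP by blast
      ultimately show "y \<in> (\<Union>U\<in>{U\<in>P. ?v U = c}. U)" using v[of U y] by auto
    qed (use v UP in auto)
    moreover have "m (\<Union>U\<in>{U\<in>P. ?v U = c}. U) = (\<Sum>U\<in>{U\<in>P. ?v U = c}. m U)"
      using fin_add_prob_UN[OF m, of "{U\<in>P. ?v U = c}" "\<lambda>U. U"] fin cl disj
      by (auto simp: disjoint_family_on_def disjoint_def)
    ultimately show ?thesis by (auto simp: sum_distrib_left)
  qed
  show ?thesis
    using sum.image_gen[OF fin, of "\<lambda>U. ?v U * m U" ?v] unfolding im level .
qed

lemma adapted_partition_fibres:
  assumes "compact_space Y" "locally_constant Y q"
    and "\<And>y. y \<in> topspace Y \<Longrightarrow> h y = h' (q y)"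
  shows "adapted_partition Y h ((\<lambda>c. {y \<in> topspace Y. q y = c}) ` q ` topspace Y)"
  unfolding adapted_partition_def partition_on_def
  using finite_image_locally_constant[OF assms(1,2)] Clopen_fibre[OF assms(2)] assms(3)
  by (auto simp: disjoint_def)

text \<open>The integral can be computed along any locally constant \<open>q\<close> through which \<open>h\<close> factors, because the
  fibres of \<open>q\<close> form an adapted partition. Two integrals become comparable by choosing the same \<open>q\<close>.\<close>

lemma lc_integral_eq:
  assumes "compact_space Y" and q: "locally_constant Y q" and m: "fin_add_prob Y m"
    and h: "\<And>y. y \<in> topspace Y \<Longrightarrow> h y = h' (q y)"
  shows "lc_integral Y h m = (\<Sum>c\<in>q ` topspace Y. h' c * m {y \<in> topspace Y. q y = c})"
proof -
  let ?fib = "\<lambda>c. {y \<in> topspace Y. q y = c}"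
  note P = adapted_partition_fibres[of Y q h h', OF assms(1,2) h]
  have inj: "inj_on ?fib (q ` topspace Y)"
    by (auto simp: inj_on_def)
  have val: "h (SOME y. y \<in> ?fib c) = h' c" if "c \<in> q ` topspace Y" for c
  proof -
    have "(SOME y. y \<in> ?fib c) \<in> ?fib c"
      by (rule someI_ex) (use that in auto)
    then show ?thesis using h by auto
  qed
  have "lc_integral Y h m = (\<Sum>U\<in>?fib ` q ` topspace Y. h (SOME y. y \<in> U) * m U)"
    unfolding lc_integral_def
  proof (rule the_equality)
    show "\<exists>P. adapted_partition Y h P \<and>
      (\<Sum>U\<in>?fib ` q ` topspace Y. h (SOME y. y \<in> U) * m U) = (\<Sum>U\<in>P. h (SOME y. y \<in> U) * m U)"
      using P by blast
  next
    fix s assume "\<exists>P. adapted_partition Y h P \<and> s = (\<Sum>U\<in>P. h (SOME y. y \<in> U) * m U)"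
    then obtain P' where "adapted_partition Y h P'" "s = (\<Sum>U\<in>P'. h (SOME y. y \<in> U) * m U)"
      by blast
    then show "s = (\<Sum>U\<in>?fib ` q ` topspace Y. h (SOME y. y \<in> U) * m U)"
      by (simp only: sum_adapted_partition[OF m P] sum_adapted_partition[OF m \<open>adapted_partition Y h P'\<close>])
  qed
  also have "\<dots> = (\<Sum>c\<in>q ` topspace Y. h' c * m (?fib c))"
    unfolding sum.reindex[OF inj] by (intro sum.cong) (use val in auto)
  finally show ?thesis .
qed

subsection \<open>The category of locally constant Markov kernels\<close>

text \<open>The upper bound \<open>1\<close> on the values follows from additivity.\<close>

lemma lc_kernelI:
  assumes "\<And>U. U \<in> Clopen Y \<Longrightarrow> locally_constant X (k U)"
    and "\<And>x. x \<in> topspace X \<Longrightarrow> fin_add_prob Y (\<lambda>U. k U x)"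
    and "\<And>U x. \<not> (U \<in> Clopen Y \<and> x \<in> topspace X) \<Longrightarrow> k U x = 0"
  shows "lc_kernel X Y k"
proof -
  have "k U x \<in> {0..1}" if "U \<in> Clopen Y" "x \<in> topspace X" for U x
    using assms(2)[OF that(2)] fin_add_prob_le_1[OF assms(2)[OF that(2)] that(1)] that(1)
    unfolding fin_add_prob_def by simp
  then show ?thesis unfolding lc_kernel_def using assms by blast
qed

lemma lc_kernelD:
  assumes "lc_kernel X Y k"
  shows "U \<in> Clopen Y \<Longrightarrow> locally_constant X (k U)"
    and "x \<in> topspace X \<Longrightarrow> fin_add_prob Y (\<lambda>U. k U x)"
    and "\<not> (U \<in> Clopen Y \<and> x \<in> topspace X) \<Longrightarrow> k U x = 0"
  using assms unfolding lc_kernel_def by simp_all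

definition kernel_id :: "'a topology \<Rightarrow> 'a set \<Rightarrow> 'a \<Rightarrow> real" where
  "kernel_id X = (\<lambda>U x. if U \<in> Clopen X \<and> x \<in> U then 1 else 0)"

definition kernel_comp :: "'a topology \<Rightarrow> 'a topology \<Rightarrow> 'a topology \<Rightarrow>
    ('a set \<Rightarrow> 'a \<Rightarrow> real) \<Rightarrow> ('a set \<Rightarrow> 'a \<Rightarrow> real) \<Rightarrow> 'a set \<Rightarrow> 'a \<Rightarrow> real" where
  "kernel_comp X Y Z g f = (\<lambda>V x. if V \<in> Clopen Z \<and> x \<in> topspace X
     then lc_integral Y (g V) (\<lambda>U. f U x) else 0)"

lemma kernel_comp_eq:
  assumes Y: "compact_space Y" and f: "lc_kernel X Y f" and q: "locally_constant Y q"
    and h: "\<And>y. y \<in> topspace Y \<Longrightarrow> g V y = h (q y)"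
    and V: "V \<in> Clopen Z" and x: "x \<in> topspace X"
  shows "kernel_comp X Y Z g f V x =
    (\<Sum>c\<in>q ` topspace Y. h c * f {y \<in> topspace Y. q y = c} x)"
  unfolding kernel_comp_def using lc_integral_eq[where h = "g V" and h' = h, OF Y q lc_kernelD(2)[OF f x] h] V x
  by simp

lemma lc_kernel_id: "lc_kernel X X (kernel_id X)"
proof (rule lc_kernelI)
  fix U assume "U \<in> Clopen X"
  then show "locally_constant X (kernel_id X U)"
    by (intro locally_constant_map[OF locally_constant_Clopen]) (auto simp: kernel_id_def)
qed (auto simp: kernel_id_def fin_add_prob_def Clopen_topspace Clopen_Un dest: Clopen_subset)

lemma lc_kernel_comp:
  assumes Y: "compact_space Y" and f: "lc_kernel X Y f" and g: "lc_kernel Y Z g"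
  shows "lc_kernel X Z (kernel_comp X Y Z g f)"
proof (rule lc_kernelI)
  fix V assume V: "V \<in> Clopen Z"
  let ?S = "g V ` topspace Y" and ?U = "\<lambda>c. {y \<in> topspace Y. g V y = c}"
  note gV = lc_kernelD(1)[OF g V]
  have eq: "kernel_comp X Y Z g f V x = (\<Sum>c\<in>?S. c * f (?U c) x)" if "x \<in> topspace X" for x
    by (rule kernel_comp_eq[OF Y f gV _ V that]) simp
  have "locally_constant X (\<lambda>x. \<lambda>c\<in>?S. f (?U c) x)"
    by (intro locally_constant_family finite_image_locally_constant[OF Y gV]
        lc_kernelD(1)[OF f] Clopen_fibre[OF gV])
  then show "locally_constant X (kernel_comp X Y Z g f V)"
  proof (rule locally_constant_map)
    fix x x' assume "x \<in> topspace X" "x' \<in> topspace X"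
      and *: "(\<lambda>c\<in>?S. f (?U c) x) = (\<lambda>c\<in>?S. f (?U c) x')"
    moreover have "f (?U c) x = f (?U c) x'" if "c \<in> ?S" for c
      using fun_cong[OF *, of c] that by simp
    ultimately show "kernel_comp X Y Z g f V x = kernel_comp X Y Z g f V x'"
      by (simp add: eq cong: sum.cong)
  qed
next
  fix x assume x: "x \<in> topspace X"
  note fx = lc_kernelD(2)[OF f x]
  show "fin_add_prob Z (\<lambda>V. kernel_comp X Y Z g f V x)"
    unfolding fin_add_prob_def
  proof (intro conjI ballI impI)
    fix V assume V: "V \<in> Clopen Z"
    note gV = lc_kernelD(1)[OF g V]
    have "kernel_comp X Y Z g f V x =
        (\<Sum>c\<in>g V ` topspace Y. c * f {y \<in> topspace Y. g V y = c} x)"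
      by (rule kernel_comp_eq[OF Y f gV _ V x]) simp
    moreover have "0 \<le> g V y" if "y \<in> topspace Y" for y
      using fin_add_prob_nonneg[OF lc_kernelD(2)[OF g that] V] .
    ultimately show "0 \<le> kernel_comp X Y Z g f V x"
      using fin_add_prob_nonneg[OF fx Clopen_fibre[OF gV]] by (auto intro!: sum_nonneg mult_nonneg_nonneg)
  next
    note Z = Clopen_topspace[of Z]
    have gZ: "g (topspace Z) y = 1" if "y \<in> topspace Y" for y
      using fin_add_prob_topspace[OF lc_kernelD(2)[OF g that]] .
    have "kernel_comp X Y Z g f (topspace Z) x =
        (\<Sum>c\<in>g (topspace Z) ` topspace Y. c * f {y \<in> topspace Y. g (topspace Z) y = c} x)"
      by (rule kernel_comp_eq[OF Y f lc_kernelD(1)[OF g Z] _ Z x]) simp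
    moreover obtain y\<^sub>0 where y\<^sub>0: "y\<^sub>0 \<in> topspace Y"
      using fin_add_prob_nonempty[OF fx] by blast
    have "g (topspace Z) ` topspace Y = {1}"
      using gZ imageI[OF y\<^sub>0, of "g (topspace Z)"] unfolding gZ[OF y\<^sub>0] by blast
    moreover have "{y \<in> topspace Y. g (topspace Z) y = 1} = topspace Y"
      using gZ by blast
    ultimately show "kernel_comp X Y Z g f (topspace Z) x = 1"
      using fin_add_prob_topspace[OF fx] by simp
  next
    fix V W assume V: "V \<in> Clopen Z" and W: "W \<in> Clopen Z" and VW: "V \<inter> W = {}"
    let ?q = "\<lambda>y. (g V y, g W y)"
    have q: "locally_constant Y ?q"
      using locally_constant_Pair lc_kernelD(1)[OF g] V W by blast
    have add: "g (V \<union> W) y = g V y + g W y" if "y \<in> topspace Y" for y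
      using fin_add_prob_Un[OF lc_kernelD(2)[OF g that] V W VW] .
    have "kernel_comp X Y Z g f V x =
        (\<Sum>c\<in>?q ` topspace Y. fst c * f {y \<in> topspace Y. ?q y = c} x)"
      by (rule kernel_comp_eq[OF Y f q _ V x]) simp
    moreover have "kernel_comp X Y Z g f W x =
        (\<Sum>c\<in>?q ` topspace Y. snd c * f {y \<in> topspace Y. ?q y = c} x)"
      by (rule kernel_comp_eq[OF Y f q _ W x]) simp
    moreover have "kernel_comp X Y Z g f (V \<union> W) x =
        (\<Sum>c\<in>?q ` topspace Y. (fst c + snd c) * f {y \<in> topspace Y. ?q y = c} x)"
      by (rule kernel_comp_eq[OF Y f q _ Clopen_Un[OF V W] x]) (simp add: add)
    ultimately show "kernel_comp X Y Z g f (V \<union> W) x =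
        kernel_comp X Y Z g f V x + kernel_comp X Y Z g f W x"
      by (simp only: distrib_right sum.distrib)
  qed
qed (auto simp: kernel_comp_def)

lemma kernel_comp_id_left:
  assumes Y: "compact_space Y" and f: "lc_kernel X Y f"
  shows "kernel_comp X Y Y (kernel_id Y) f = f"
proof (intro ext)
  fix V x
  show "kernel_comp X Y Y (kernel_id Y) f V x = f V x"
  proof (cases "V \<in> Clopen Y \<and> x \<in> topspace X")
    case True
    then have V: "V \<in> Clopen Y" and x: "x \<in> topspace X" by auto
    have VY: "V \<subseteq> topspace Y" "{y. y \<in> topspace Y \<and> y \<in> V} = V" using Clopen_subset[OF V] by auto
    have "kernel_comp X Y Y (kernel_id Y) f V x =
        (\<Sum>c\<in>(\<lambda>y. y \<in> V) ` topspace Y. of_bool c * f {y \<in> topspace Y. (y \<in> V) = c} x)"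
      by (rule kernel_comp_eq[OF Y f locally_constant_Clopen[OF V] _ V x])
        (use V in \<open>auto simp: kernel_id_def\<close>)
    also have "\<dots> = (\<Sum>c\<in>(\<lambda>y. y \<in> V) ` topspace Y. if c = True then f V x else 0)"
      by (intro sum.cong) (use VY in auto)
    also have "\<dots> = (if True \<in> (\<lambda>y. y \<in> V) ` topspace Y then f V x else 0)"
      by (subst sum.delta) auto
    also have "\<dots> = f V x"
      using VY fin_add_prob_empty[OF lc_kernelD(2)[OF f x]] by (cases "V = {}") auto
    finally show ?thesis .
  qed (auto simp: kernel_comp_def lc_kernelD(3)[OF f])
qed

lemma kernel_comp_id_right:
  assumes X: "compact_space X" and g: "lc_kernel X Y g"
  shows "kernel_comp X X Y g (kernel_id X) = g"
proof (intro ext)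
  fix V x
  show "kernel_comp X X Y g (kernel_id X) V x = g V x"
  proof (cases "V \<in> Clopen Y \<and> x \<in> topspace X")
    case True
    then have V: "V \<in> Clopen Y" and x: "x \<in> topspace X" by auto
    note gV = lc_kernelD(1)[OF g V]
    have "kernel_comp X X Y g (kernel_id X) V x =
        (\<Sum>c\<in>g V ` topspace X. c * kernel_id X {y \<in> topspace X. g V y = c} x)"
      by (rule kernel_comp_eq[OF X lc_kernel_id gV _ V x]) simp
    also have "\<dots> = (\<Sum>c\<in>g V ` topspace X. if c = g V x then c else 0)"
      by (intro sum.cong) (use x Clopen_fibre[OF gV] in \<open>auto simp: kernel_id_def\<close>)
    also have "\<dots> = g V x"
      using sum.delta[OF finite_image_locally_constant[OF X gV], of "g V x" "\<lambda>c. c"] x by simp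
    finally show ?thesis .
  qed (auto simp: kernel_comp_def lc_kernelD(3)[OF g])
qed

text \<open>Interchange of two finite sums. The inner function \<open>q\<close> records the \<open>g\<close>-measures of all level sets
  of \<open>h W\<close> at once, so that a single partition of \<open>B\<close> serves for all summands.\<close>

lemma kernel_comp_assoc:
  assumes B: "compact_space B" and C: "compact_space C"
    and f: "lc_kernel A B f" and g: "lc_kernel B C g" and h: "lc_kernel C D h"
  shows "kernel_comp A C D h (kernel_comp A B C g f) = kernel_comp A B D (kernel_comp B C D h g) f"
proof (intro ext)
  fix W x
  show "kernel_comp A C D h (kernel_comp A B C g f) W x =
    kernel_comp A B D (kernel_comp B C D h g) f W x"
  proof (cases "W \<in> Clopen D \<and> x \<in> topspace A")
    case True
    then have W: "W \<in> Clopen D" and x: "x \<in> topspace A" by auto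
    note hW = lc_kernelD(1)[OF h W]
    let ?S = "h W ` topspace C" and ?V = "\<lambda>c. {z \<in> topspace C. h W z = c}"
    define q where "q y = (\<lambda>c\<in>?S. g (?V c) y)" for y
    let ?T = "q ` topspace B" and ?U = "\<lambda>d. {y \<in> topspace B. q y = d}"
    have q: "locally_constant B q"
      unfolding q_def by (intro locally_constant_family finite_image_locally_constant[OF C hW]
          lc_kernelD(1)[OF g] Clopen_fibre[OF hW])
    have gf: "kernel_comp A B C g f (?V c) x = (\<Sum>d\<in>?T. d c * f (?U d) x)" if "c \<in> ?S" for c
      by (rule kernel_comp_eq[OF B f q _ Clopen_fibre[OF hW] x]) (use that in \<open>simp add: q_def\<close>)
    have hg: "kernel_comp B C D h g W y = (\<Sum>c\<in>?S. c * q y c)" if "y \<in> topspace B" for y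
      by (subst kernel_comp_eq[OF C g hW, of h W "\<lambda>c. c" D y]) (use W that in \<open>auto simp: q_def\<close>)
    have "kernel_comp A C D h (kernel_comp A B C g f) W x =
        (\<Sum>c\<in>?S. c * kernel_comp A B C g f (?V c) x)"
      by (rule kernel_comp_eq[OF C lc_kernel_comp[OF B f g] hW _ W x]) simp
    also have "\<dots> = (\<Sum>c\<in>?S. \<Sum>d\<in>?T. c * d c * f (?U d) x)"
      by (intro sum.cong refl) (simp add: gf sum_distrib_left mult.assoc)
    also have "\<dots> = (\<Sum>d\<in>?T. (\<Sum>c\<in>?S. c * d c) * f (?U d) x)"
      by (subst sum.swap) (simp add: sum_distrib_right)
    also have "\<dots> = kernel_comp A B D (kernel_comp B C D h g) f W x"
      by (rule kernel_comp_eq[OF B f q _ W x, symmetric]) (simp add: hg)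
    finally show ?thesis .
  qed (auto simp: kernel_comp_def)
qed

lemma hom_StoneStoch_lc:
  "f \<in> hom StoneStoch_lc X Y \<longleftrightarrow>
    Stone_space X \<and> Stone_space Y \<and> (\<exists>k. f = Arr X Y k \<and> lc_kernel X Y k)"
  unfolding hom_def StoneStoch_lc_def by (cases f) auto

lemma Comp_StoneStoch_lc:
  "Comp StoneStoch_lc (Arr Y Z g) (Arr X Y f) = Arr X Z (kernel_comp X Y Z g f)"
  unfolding StoneStoch_lc_def kernel_comp_def by (simp cong: if_cong)

lemma Idn_StoneStoch_lc: "Idn StoneStoch_lc X = Arr X X (kernel_id X)"
  unfolding StoneStoch_lc_def kernel_id_def by simp

theorem category_StoneStoch_lc: "category (StoneStoch_lc :: ('a topology, _) cat)"
proof
  have compact: "compact_space X" if "Stone_space X" for X :: "'a topology"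
    using that unfolding Stone_space_def by simp
  fix f g h and A B C D :: "'a topology"
  assume f: "f \<in> hom StoneStoch_lc A B"
  show "Comp StoneStoch_lc (Idn StoneStoch_lc B) f = f"
    "Comp StoneStoch_lc f (Idn StoneStoch_lc A) = f"
    using f by (auto simp: hom_StoneStoch_lc Idn_StoneStoch_lc Comp_StoneStoch_lc
        kernel_comp_id_left kernel_comp_id_right compact)
  assume g: "g \<in> hom StoneStoch_lc B C"
  show "Comp StoneStoch_lc g f \<in> hom StoneStoch_lc A C"
    using f g by (auto simp: hom_StoneStoch_lc Comp_StoneStoch_lc lc_kernel_comp compact)
  assume h: "h \<in> hom StoneStoch_lc C D"
  show "Comp StoneStoch_lc h (Comp StoneStoch_lc g f) = Comp StoneStoch_lc (Comp StoneStoch_lc h g) f"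
    using f g h by (auto simp: hom_StoneStoch_lc Comp_StoneStoch_lc kernel_comp_assoc compact)
next
  fix A :: "'a topology" assume "A \<in> Obj StoneStoch_lc"
  then show "Idn StoneStoch_lc A \<in> hom StoneStoch_lc A A"
    by (auto simp: hom_StoneStoch_lc Idn_StoneStoch_lc lc_kernel_id) (auto simp: StoneStoch_lc_def)
qed (auto simp: StoneStoch_lc_def)

section \<open>Cantor spaces\<close>

lemma topspace_two_pow: "topspace (two_pow N) = extensional N"
  unfolding two_pow_def by (simp add: PiE_UNIV_domain PiE_def)

lemma compact_two_pow: "compact_space (two_pow N)"
  unfolding two_pow_def by (simp add: compact_space_product_topology compact_space_discrete_topology)

lemma openin_two_pow_cylinder:
  assumes "finite K"
  shows "openin (two_pow N) {x' \<in> extensional N. \<forall>n\<in>K \<inter> N. x' n = x n}"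
proof -
  let ?S = "\<lambda>n. if n \<in> K then {x n} else UNIV"
  have "{x' \<in> extensional N. \<forall>n\<in>K \<inter> N. x' n = x n} = PiE N ?S"
  proof (rule set_eqI)
    fix y
    have "y n \<in> ?S n \<longleftrightarrow> (n \<in> K \<longrightarrow> y n = x n)" for n by simp
    then show "y \<in> {x' \<in> extensional N. \<forall>n\<in>K \<inter> N. x' n = x n} \<longleftrightarrow> y \<in> PiE N ?S"
      unfolding PiE_iff by blast
  qed
  moreover have "{n \<in> N. ?S n \<noteq> UNIV} \<subseteq> K" by auto
  then have "finite {n \<in> N. ?S n \<noteq> UNIV}" using assms finite_subset by blast
  then have "openin (two_pow N) (PiE N ?S)"
    unfolding two_pow_def openin_PiE_gen by simp
  ultimately show ?thesis by simp
qed

text \<open>Compactness: every point has a basic neighbourhood, given by finitely many coordinates, on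
  which \<open>h\<close> is constant; finitely many of these neighbourhoods cover the space, and the coordinates
  used by them determine \<open>h\<close>.\<close>

lemma locally_constant_two_pow_iff:
  "locally_constant (two_pow N) h \<longleftrightarrow>
    (\<exists>K. finite K \<and> K \<subseteq> N \<and> (\<forall>x\<in>extensional N. \<forall>x'\<in>extensional N. (\<forall>n\<in>K. x' n = x n) \<longrightarrow> h x' = h x))"
    (is "?L \<longleftrightarrow> ?R")
proof
  assume ?R
  then obtain K where K: "finite K" "K \<subseteq> N"
    and h: "\<forall>x\<in>extensional N. \<forall>x'\<in>extensional N. (\<forall>n\<in>K. x' n = x n) \<longrightarrow> h x' = h x"
    by (elim exE conjE)
  show ?L unfolding locally_constant_def topspace_two_pow
  proof
    fix x :: "nat \<Rightarrow> bool" assume x: "x \<in> extensional N"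
    let ?V = "{x' \<in> extensional N. \<forall>n\<in>K \<inter> N. x' n = x n}"
    show "\<exists>V. openin (two_pow N) V \<and> x \<in> V \<and> (\<forall>x'\<in>V. h x' = h x)"
    proof (intro exI[of _ ?V] conjI ballI)
      show "openin (two_pow N) ?V" by (rule openin_two_pow_cylinder[OF K(1)])
      show "x \<in> ?V" using x by simp
      fix x' assume x': "x' \<in> ?V"
      show "h x' = h x"
      proof (rule h[rule_format, OF x])
        show "x' \<in> extensional N" using x' by simp
        fix n assume "n \<in> K"
        then have "n \<in> K \<inter> N" using K(2) by blast
        then show "x' n = x n" using x' by simp
      qed
    qed
  qed
next
  assume L: ?L
  define good where "good x K \<longleftrightarrow> finite K \<and> K \<subseteq> N \<and>
      (\<forall>x'\<in>extensional N. (\<forall>n\<in>K. x' n = x n) \<longrightarrow> h x' = h x)" for x K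
  have "\<exists>K. good x K" if x: "x \<in> extensional N" for x
  proof -
    obtain V where V: "openin (two_pow N) V" "x \<in> V" "\<forall>x'\<in>V. h x' = h x"
      using L x unfolding locally_constant_def topspace_two_pow by blast
    then obtain U where U: "finite {n \<in> N. U n \<noteq> UNIV}" "x \<in> PiE N U" "PiE N U \<subseteq> V"
      unfolding two_pow_def openin_product_topology_alt by (auto simp: topspace_discrete_topology)
    have "x' \<in> PiE N U" if "x' \<in> extensional N" "\<forall>n\<in>{n \<in> N. U n \<noteq> UNIV}. x' n = x n" for x'
      unfolding PiE_iff
    proof (intro conjI ballI that(1))
      fix n assume "n \<in> N"
      then show "x' n \<in> U n"
        using that(2) U(2) by (cases "U n = UNIV") (auto simp: PiE_iff)
    qed
    then have "h x' = h x" if "x' \<in> extensional N" "\<forall>n\<in>{n \<in> N. U n \<noteq> UNIV}. x' n = x n" for x'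
      using V(3)[rule_format, OF subsetD[OF U(3)]] that by metis
    then have "good x {n \<in> N. U n \<noteq> UNIV}"
      unfolding good_def using U(1) by (intro conjI ballI impI) auto
    then show ?thesis ..
  qed
  then obtain \<kappa> where \<kappa>: "\<And>x. x \<in> extensional N \<Longrightarrow> good x (\<kappa> x)"
    by metis
  define C where "C x = {x' \<in> extensional N. \<forall>n\<in>\<kappa> x \<inter> N. x' n = x n}" for x
  have "openin (two_pow N) U" if "U \<in> C ` extensional N" for U
    using that openin_two_pow_cylinder \<kappa> unfolding C_def good_def by blast
  moreover have "topspace (two_pow N) \<subseteq> \<Union> (C ` extensional N)"
    unfolding topspace_two_pow C_def by blast
  ultimately obtain \<F> where \<F>: "finite \<F>" "\<F> \<subseteq> C ` extensional N" "topspace (two_pow N) \<subseteq> \<Union>\<F>"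
    using compact_two_pow[of N] unfolding compact_space_alt by (metis (no_types, lifting))
  then obtain I where I: "finite I" "I \<subseteq> extensional N" "\<F> = C ` I"
    by (meson finite_subset_image)
  define K where "K = (\<Union>x\<in>I. \<kappa> x)"
  have "h x' = h x" if x: "x \<in> extensional N" and x': "x' \<in> extensional N"
    and eq: "\<forall>n\<in>K. x' n = x n" for x x'
  proof -
    obtain z where z: "z \<in> I" "x \<in> C z"
      using \<F>(3) x unfolding I(3) topspace_two_pow by blast
    note good = \<kappa>[OF subsetD[OF I(2) z(1)], unfolded good_def]
    have "\<forall>n\<in>\<kappa> z. x n = z n" using z(2) good unfolding C_def by blast
    moreover from this have "\<forall>n\<in>\<kappa> z. x' n = z n"
      using eq z(1) unfolding K_def by (metis UN_I)
    ultimately have "h x = h z" "h x' = h z"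
      using good x x' by blast+
    then show "h x' = h x" by simp
  qed
  moreover have "finite K" "K \<subseteq> N"
    unfolding K_def using I(1,2) \<kappa> good_def by blast+
  ultimately show ?R by blast
qed

lemma Stone_space_two_pow: "Stone_space (two_pow N)"
  unfolding Stone_space_def
proof (intro conjI allI impI)
  show "compact_space (two_pow N)" by (rule compact_two_pow)
  show "Hausdorff_space (two_pow N)"
    unfolding two_pow_def by (simp add: Hausdorff_space_product_topology)
next
  fix W x assume *: "openin (two_pow N) W \<and> x \<in> W"
  then obtain U where U: "finite {n \<in> N. U n \<noteq> UNIV}" "x \<in> PiE N U" "PiE N U \<subseteq> W"
    unfolding two_pow_def openin_product_topology_alt by (auto simp: topspace_discrete_topology)
  let ?K = "{n \<in> N. U n \<noteq> UNIV}"
  have "locally_constant (two_pow N) (\<lambda>x. x \<in> PiE N U)"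
    unfolding locally_constant_two_pow_iff
  proof (intro exI[of _ ?K] conjI ballI impI)
    fix y y' :: "nat \<Rightarrow> bool"
    assume y: "y \<in> extensional N" "y' \<in> extensional N" and eq: "\<forall>n\<in>?K. y' n = y n"
    have "y' n \<in> U n \<longleftrightarrow> y n \<in> U n" if "n \<in> N" for n
      using eq that by (cases "U n = UNIV") auto
    then show "(y' \<in> PiE N U) = (y \<in> PiE N U)"
      using y by (simp add: PiE_iff)
  qed (use U(1) in auto)
  from Clopen_Collect[OF this, of "\<lambda>b. b"]
  have "PiE N U \<in> Clopen (two_pow N)"
    unfolding topspace_two_pow by (simp add: PiE_def Int_def conj_commute)
  then show "\<exists>U\<in>Clopen (two_pow N). x \<in> U \<and> U \<subseteq> W"
    using U by blast
qed

section \<open>Deletions in \<open>BinStoch\<close>\<close>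

lemma finite_bin_pow: "finite (bin_pow n)"
  unfolding bin_pow_def using finite_lists_length_eq[of "UNIV :: bool set" n] by simp

lemma hom_BinStoch: "f \<in> hom BinStoch m n \<longleftrightarrow> (\<exists>k. f = Arr m n k \<and> stochastic m n k)"
  unfolding hom_def BinStoch_def by (cases f) auto

lemma Comp_BinStoch:
  "Comp BinStoch (Arr n p g) (Arr m n f) = Arr m p (\<lambda>z x. \<Sum>y\<in>bin_pow n. g z y * f y x)"
  unfolding BinStoch_def by simp

lemma Comp_hom_BinStoch:
  assumes "f \<in> hom BinStoch m n" "g \<in> hom BinStoch n p"
  shows "Comp BinStoch g f \<in> hom BinStoch m p"
proof -
  obtain f' g' where f: "f = Arr m n f'" "stochastic m n f'" and g: "g = Arr n p g'" "stochastic n p g'"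
    using assms unfolding hom_BinStoch by blast
  have "(\<Sum>z\<in>bin_pow p. \<Sum>y\<in>bin_pow n. g' z y * f' y x) = 1" if "x \<in> bin_pow m" for x
  proof -
    have "(\<Sum>z\<in>bin_pow p. \<Sum>y\<in>bin_pow n. g' z y * f' y x) =
        (\<Sum>y\<in>bin_pow n. (\<Sum>z\<in>bin_pow p. g' z y) * f' y x)"
      by (subst sum.swap) (simp add: sum_distrib_right)
    also have "\<dots> = (\<Sum>y\<in>bin_pow n. f' y x)"
      by (intro sum.cong) (use g(2) in \<open>auto simp: stochastic_def\<close>)
    also have "\<dots> = 1" using f(2) that by (auto simp: stochastic_def)
    finally show ?thesis .
  qed
  then have "stochastic m p (\<lambda>z x. \<Sum>y\<in>bin_pow n. g' z y * f' y x)"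
    using f(2) g(2) unfolding stochastic_def
    by (auto intro!: sum_nonneg sum.neutral simp del: mult_eq_0_iff)
  then show ?thesis unfolding f g Comp_BinStoch hom_BinStoch by blast
qed

lemma hom_BinStoch_eqI:
  assumes "f \<in> hom BinStoch m n" "g \<in> hom BinStoch m n"
    and "\<And>y x. y \<in> bin_pow n \<Longrightarrow> x \<in> bin_pow m \<Longrightarrow> act f y x = act g y x"
  shows "f = g"
proof -
  obtain f' g' where f: "f = Arr m n f'" "stochastic m n f'" and g: "g = Arr m n g'" "stochastic m n g'"
    using assms unfolding hom_BinStoch by blast
  have "f' y x = g' y x" for y x
  proof (cases "y \<in> bin_pow n \<and> x \<in> bin_pow m")
    case True
    then show ?thesis using assms(3)[of y x] f(1) g(1) by simp
  next
    case False
    then show ?thesis using f(2) g(2) unfolding stochastic_def by simp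
  qed
  then have "f' = g'" by blast
  then show ?thesis using f g by simp
qed

text \<open>Identities, unitors, deletions and projections are all matrices of functions, and
  composition and tensor product of such matrices are computed on the functions.\<close>

definition det_matrix ::
  "nat \<Rightarrow> nat \<Rightarrow> (bool list \<Rightarrow> bool list) \<Rightarrow> (nat, bool list \<Rightarrow> bool list \<Rightarrow> real) arr" where
  "det_matrix m n \<phi> = Arr m n (\<lambda>y x. if x \<in> bin_pow m \<and> y = \<phi> x then 1 else 0)"

lemma det_matrix_hom:
  assumes "\<phi> \<in> bin_pow m \<rightarrow> bin_pow n"
  shows "det_matrix m n \<phi> \<in> hom BinStoch m n"
  unfolding det_matrix_def hom_BinStoch stochastic_def
  using assms finite_bin_pow by (auto simp: sum.delta)

lemma Comp_det_matrix_right: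
  assumes "\<phi> \<in> bin_pow m \<rightarrow> bin_pow n" "x \<in> bin_pow m"
  shows "act (Comp BinStoch (Arr n p g) (det_matrix m n \<phi>)) z x = g z (\<phi> x)"
proof -
  have "(\<Sum>y\<in>bin_pow n. g z y * (if x \<in> bin_pow m \<and> y = \<phi> x then 1 else 0)) =
      (\<Sum>y\<in>bin_pow n. if y = \<phi> x then g z y else 0)"
    by (intro sum.cong) (use assms in auto)
  also have "\<dots> = g z (\<phi> x)"
    using assms finite_bin_pow by (subst sum.delta) auto
  finally show ?thesis unfolding det_matrix_def Comp_BinStoch by simp
qed

lemma Comp_det_matrix_left:
  "act (Comp BinStoch (det_matrix n p \<phi>) (Arr m n f)) z x = (\<Sum>y | y \<in> bin_pow n \<and> \<phi> y = z. f y x)"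
proof -
  have "(\<Sum>y\<in>bin_pow n. (if y \<in> bin_pow n \<and> z = \<phi> y then 1 else 0) * f y x) =
      (\<Sum>y\<in>bin_pow n. if \<phi> y = z then f y x else 0)"
    by (intro sum.cong) auto
  also have "\<dots> = (\<Sum>y | y \<in> bin_pow n \<and> \<phi> y = z. f y x)"
    using finite_bin_pow by (subst sum.inter_filter[symmetric]) auto
  finally show ?thesis unfolding det_matrix_def Comp_BinStoch by simp
qed

lemma Comp_det_matrix:
  assumes "\<phi> \<in> bin_pow m \<rightarrow> bin_pow n" "\<psi> \<in> bin_pow n \<rightarrow> bin_pow p"
  shows "Comp BinStoch (det_matrix n p \<psi>) (det_matrix m n \<phi>) = det_matrix m p (\<psi> \<circ> \<phi>)"
proof (rule hom_BinStoch_eqI)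
  show "Comp BinStoch (det_matrix n p \<psi>) (det_matrix m n \<phi>) \<in> hom BinStoch m p"
    using Comp_hom_BinStoch[OF det_matrix_hom[OF assms(1)] det_matrix_hom[OF assms(2)]] .
  show "det_matrix m p (\<psi> \<circ> \<phi>) \<in> hom BinStoch m p"
    by (intro det_matrix_hom) (use assms in auto)
  fix z x assume "z \<in> bin_pow p" and x: "x \<in> bin_pow m"
  have "\<phi> x \<in> bin_pow n" using assms x by auto
  then show "act (Comp BinStoch (det_matrix n p \<psi>) (det_matrix m n \<phi>)) z x = act (det_matrix m p (\<psi> \<circ> \<phi>)) z x"
    using Comp_det_matrix_right[OF assms(1) x, of p] x by (simp add: det_matrix_def)
qed

lemma Idn_BinStoch: "Idn BinStoch n = det_matrix n n id"
  and LUnit_BinStoch: "LUnit BinStoch n = det_matrix n n id"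
  unfolding BinStoch_def det_matrix_def by (auto intro!: ext)

lemma TenM_det_matrix:
  assumes "\<phi> \<in> bin_pow m \<rightarrow> bin_pow n" "\<psi> \<in> bin_pow p \<rightarrow> bin_pow q"
  shows "TenM BinStoch (det_matrix m n \<phi>) (det_matrix p q \<psi>) =
    det_matrix (m + p) (n + q) (\<lambda>x. \<phi> (take m x) @ \<psi> (drop m x))"
proof -
  have dom: "x \<in> bin_pow (m + p) \<longleftrightarrow> take m x \<in> bin_pow m \<and> drop m x \<in> bin_pow p" for x
    unfolding bin_pow_def by auto
  have cod: "y = \<phi> (take m x) @ \<psi> (drop m x) \<longleftrightarrow> take n y = \<phi> (take m x) \<and> drop n y = \<psi> (drop m x)"
    if "take m x \<in> bin_pow m" "drop m x \<in> bin_pow p" for x y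
  proof -
    have "length (\<phi> (take m x)) = n"
      using assms(1) that(1) unfolding bin_pow_def by auto
    then show ?thesis by (metis append_eq_conv_conj append_take_drop_id)
  qed
  have "(if take m x \<in> bin_pow m \<and> take n y = \<phi> (take m x) then 1 else 0) *
      (if drop m x \<in> bin_pow p \<and> drop n y = \<psi> (drop m x) then 1 else 0) =
      (if x \<in> bin_pow (m + p) \<and> y = \<phi> (take m x) @ \<psi> (drop m x) then 1 else (0::real))" for x y
  proof (cases "take m x \<in> bin_pow m \<and> drop m x \<in> bin_pow p")
    case True
    then show ?thesis by (simp only: dom cod simp_thms split: if_split) simp
  qed (auto simp: dom)
  then show ?thesis
    unfolding BinStoch_def det_matrix_def by simp
qed

text \<open>The only word of length \<open>0\<close> receives probability \<open>1\<close>, so the unit is terminal.\<close>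

lemma del_BinStoch: "del BinStoch n = det_matrix n 0 (\<lambda>_. [])"
proof -
  have Unit: "Unit BinStoch = 0" unfolding BinStoch_def by simp
  have b0: "bin_pow 0 = {[]}" unfolding bin_pow_def by auto
  have hom: "det_matrix n 0 (\<lambda>_. []) \<in> hom BinStoch n 0"
    by (rule det_matrix_hom) (simp add: b0)
  show ?thesis
    unfolding del_def Unit
  proof (rule the_equality)
    show "det_matrix n 0 (\<lambda>_. []) \<in> hom BinStoch n 0" by (rule hom)
    fix f assume f: "f \<in> hom BinStoch n 0"
    show "f = det_matrix n 0 (\<lambda>_. [])"
      by (rule hom_BinStoch_eqI[OF f hom])
        (use f in \<open>auto simp: hom_BinStoch det_matrix_def stochastic_def b0\<close>)
  qed
qed

abbreviation width :: "('j \<rightharpoonup> nat) \<Rightarrow> 'j list \<Rightarrow> nat" where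
  "width \<equiv> tensor_list BinStoch"

lemma width_simps [simp]: "width X [] = 0" "width X (j # js) = the (X j) + width X js"
  unfolding tensor_list_def BinStoch_def by simp_all

text \<open>The function on words whose matrix is \<open>proj_list\<close>.\<close>

primrec keep :: "('j \<rightharpoonup> nat) \<Rightarrow> 'j set \<Rightarrow> 'j list \<Rightarrow> bool list \<Rightarrow> bool list" where
  "keep X F [] a = []"
| "keep X F (j # js) a =
    (if j \<in> F then take (the (X j)) a else []) @ keep X F js (drop (the (X j)) a)"

lemma keep_bin_pow:
  "keep X F js \<in> bin_pow (width X js) \<rightarrow> bin_pow (width X (filter (\<lambda>i. i \<in> F) js))"
proof (induction js)
  case Nil
  then show ?case by (simp add: bin_pow_def)
next
  case (Cons j js)
  have "drop (the (X j)) a \<in> bin_pow (width X js)" if "a \<in> bin_pow (width X (j # js))" for a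
    using that unfolding bin_pow_def by simp
  from funcset_mem[OF Cons this] show ?case
    unfolding bin_pow_def by auto
qed

lemma proj_list_BinStoch:
  "proj_list BinStoch X F js = det_matrix (width X js) (width X (filter (\<lambda>i. i \<in> F) js)) (keep X F js)"
proof (induction js)
  case Nil
  have "Unit BinStoch = 0" unfolding BinStoch_def by simp
  then show ?case by (auto simp: Idn_BinStoch det_matrix_def bin_pow_def intro!: ext)
next
  case (Cons j js)
  let ?n = "the (X j)" and ?w = "width X js" and ?w' = "width X (filter (\<lambda>i. i \<in> F) js)"
  note k = keep_bin_pow[of X F js]
  show ?case
  proof (cases "j \<in> F")
    case True
    have id: "id \<in> bin_pow ?n \<rightarrow> bin_pow ?n" by auto
    show ?thesis
      using True TenM_det_matrix[OF id k] by (simp add: Cons Idn_BinStoch)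
  next
    case False
    have nil: "(\<lambda>_. []) \<in> bin_pow ?n \<rightarrow> bin_pow 0" by (auto simp: bin_pow_def)
    have d: "(\<lambda>x. keep X F js (drop ?n x)) \<in> bin_pow (?n + ?w) \<rightarrow> bin_pow ?w'"
      using funcset_mem[OF k] by (auto simp: bin_pow_def)
    have id: "id \<in> bin_pow ?w' \<rightarrow> bin_pow ?w'" by auto
    show ?thesis
      using False TenM_det_matrix[OF nil k] Comp_det_matrix[OF d id]
      by (simp add: Cons LUnit_BinStoch del_BinStoch comp_def)
  qed
qed

section \<open>The Cantor space of an infinite tensor product\<close>

definition bits :: "('j \<rightharpoonup> nat) \<Rightarrow> ('j \<times> nat) set" where
  "bits X = Sigma (dom X) (\<lambda>j. {..<the (X j)})"

text \<open>The enumeration \<open>to_nat_on\<close> uses an initial segment of the natural numbers on a finite set and all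
  natural numbers on a countably infinite one. Hence the space of bit assignments is literally one
  of the objects of \<open>CantorStoch_lc\<close>.\<close>

definition coord :: "('j \<rightharpoonup> nat) \<Rightarrow> 'j \<times> nat \<Rightarrow> nat" where
  "coord X = to_nat_on (bits X)"

definition coords :: "('j \<rightharpoonup> nat) \<Rightarrow> nat set" where
  "coords X = coord X ` bits X"

abbreviation cantor :: "('j \<rightharpoonup> nat) \<Rightarrow> (nat \<Rightarrow> bool) topology" where
  "cantor X \<equiv> two_pow (coords X)"

abbreviation points :: "('j \<rightharpoonup> nat) \<Rightarrow> (nat \<Rightarrow> bool) set" where
  "points X \<equiv> extensional (coords X)"

primrec read_bits :: "('j \<rightharpoonup> nat) \<Rightarrow> 'j list \<Rightarrow> (nat \<Rightarrow> bool) \<Rightarrow> bool list" where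
  "read_bits X [] x = []"
| "read_bits X (j # js) x = map (\<lambda>i. x (coord X (j, i))) [0..<the (X j)] @ read_bits X js x"

text \<open>The quotient map onto \<open>2\<close> to the power \<open>tensor_over BinStoch X F\<close>: the word formed by the bits of
  the factors in \<open>F\<close>.\<close>

definition observe :: "('j::linorder \<rightharpoonup> nat) \<Rightarrow> 'j set \<Rightarrow> (nat \<Rightarrow> bool) \<Rightarrow> bool list" where
  "observe X F = read_bits X (sorted_list_of_set F)"

abbreviation dimension :: "('j::linorder \<rightharpoonup> nat) \<Rightarrow> 'j set \<Rightarrow> nat" where
  "dimension \<equiv> tensor_over BinStoch"

lemma countable_bits: "countable (dom X) \<Longrightarrow> countable (bits X)"
  unfolding bits_def by (intro countable_SIGMA) auto

lemma read_bits_bin_pow: "read_bits X js x \<in> bin_pow (width X js)"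
  by (induction js) (auto simp: bin_pow_def)

lemma keep_read_bits: "keep X F js (read_bits X js x) = read_bits X (filter (\<lambda>i. i \<in> F) js) x"
  by (induction js) auto

lemma read_bits_eq_iff:
  "read_bits X js x = read_bits X js x' \<longleftrightarrow>
    (\<forall>j\<in>set js. \<forall>i<the (X j). x (coord X (j, i)) = x' (coord X (j, i)))"
  by (induction js) auto

text \<open>Positions in a word over distinct factors are distinct bits, so the bits can be prescribed
  independently.\<close>

lemma exists_bit_assignment:
  assumes "distinct js" "a \<in> bin_pow (width X js)"
  shows "\<exists>b. \<forall>x. (\<forall>j\<in>set js. \<forall>i<the (X j). x (coord X (j, i)) = b (j, i)) \<longrightarrow> read_bits X js x = a"
  using assms
proof (induction js arbitrary: a)
  case Nil
  then show ?case by (auto simp: bin_pow_def)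
next
  case (Cons j js)
  let ?n = "the (X j)"
  have "drop ?n a \<in> bin_pow (width X js)" and len: "?n \<le> length a"
    using Cons.prems(2) by (auto simp: bin_pow_def)
  then obtain b where b: "\<And>x. \<forall>j\<in>set js. \<forall>i<the (X j). x (coord X (j, i)) = b (j, i) \<Longrightarrow> read_bits X js x = drop ?n a"
    using Cons.IH[of "drop ?n a"] Cons.prems(1) by auto
  \<comment> \<open>The first block of the word fixes the bits of the factor \<open>j\<close>, which does not occur in \<open>js\<close>.\<close>
  let ?b = "\<lambda>(j', i). if j' = j then a ! i else b (j', i)"
  have "read_bits X (j # js) x = a"
    if x: "\<forall>j'\<in>set (j # js). \<forall>i<the (X j'). x (coord X (j', i)) = ?b (j', i)" for x
  proof -
    have "\<forall>j'\<in>set js. \<forall>i<the (X j'). x (coord X (j', i)) = b (j', i)"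
    proof (intro ballI allI impI)
      fix j' i assume *: "j' \<in> set js" "i < the (X j')"
      have "j' \<noteq> j" using *(1) Cons.prems(1) by auto
      then show "x (coord X (j', i)) = b (j', i)"
        using x[rule_format, of j' i] * by simp
    qed
    then have "read_bits X js x = drop ?n a" by (rule b)
    moreover have "map (\<lambda>i. x (coord X (j, i))) [0..<?n] = take ?n a"
    proof (rule nth_equalityI)
      fix i assume "i < length (map (\<lambda>i. x (coord X (j, i))) [0..<?n])"
      then show "map (\<lambda>i. x (coord X (j, i))) [0..<?n] ! i = take ?n a ! i"
        using x[rule_format, of j i] by simp
    qed (use len in simp)
    ultimately show ?thesis by simp
  qed
  then show ?case by (intro exI[of _ ?b]) blast
qed

lemma read_bits_surj:
  assumes X: "countable (dom X)" and js: "distinct js" "set js \<subseteq> dom X" and a: "a \<in> bin_pow (width X js)"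
  shows "\<exists>x\<in>points X. read_bits X js x = a"
proof -
  obtain b where b: "\<And>x. \<forall>j\<in>set js. \<forall>i<the (X j). x (coord X (j, i)) = b (j, i) \<Longrightarrow> read_bits X js x = a"
    using exists_bit_assignment[OF js(1) a] by metis
  define x where "x = (\<lambda>n\<in>coords X. b (from_nat_into (bits X) n))"
  have "x (coord X (j, i)) = b (j, i)" if "j \<in> set js" "i < the (X j)" for j i
  proof -
    have "(j, i) \<in> bits X" using that js(2) unfolding bits_def by auto
    then show ?thesis
      unfolding x_def coords_def coord_def using countable_bits[OF X] by simp
  qed
  then have "read_bits X js x = a" using b by blast
  moreover have "x \<in> points X" unfolding x_def by simp
  ultimately show ?thesis by blast
qed

lemma FinLO_Un: "F \<in> FinLO J \<Longrightarrow> F' \<in> FinLO J \<Longrightarrow> F \<union> F' \<in> FinLO J"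
  unfolding FinLO_def by auto

lemma observe_image:
  assumes "countable (dom X)" "F \<in> FinLO (dom X)"
  shows "observe X F ` points X = bin_pow (dimension X F)"
proof -
  have "distinct (sorted_list_of_set F)" "set (sorted_list_of_set F) \<subseteq> dom X"
    using assms(2) unfolding FinLO_def by auto
  from read_bits_surj[OF assms(1) this] show ?thesis
    unfolding observe_def tensor_over_def using read_bits_bin_pow[of X "sorted_list_of_set F"] by blast
qed

lemma observe_bin_pow: "observe X F x \<in> bin_pow (dimension X F)"
  unfolding observe_def tensor_over_def by (rule read_bits_bin_pow)

lemma observe_mono:
  assumes "F \<subseteq> F'" "finite F'" "observe X F' x = observe X F' x'"
  shows "observe X F x = observe X F x'"
  using assms finite_subset[OF assms(1,2)] unfolding observe_def read_bits_eq_iff by auto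

lemma locally_constant_observe:
  assumes "F \<in> FinLO (dom X)"
  shows "locally_constant (cantor X) (observe X F)"
  unfolding locally_constant_two_pow_iff
proof (intro exI conjI ballI impI)
  let ?B = "Sigma F (\<lambda>j. {..<the (X j)})"
  have F: "finite F" "F \<subseteq> dom X" using assms unfolding FinLO_def by auto
  show "finite (coord X ` ?B)" using F by blast
  show "coord X ` ?B \<subseteq> coords X" unfolding coords_def bits_def using F by blast
  fix x x' :: "nat \<Rightarrow> bool"
  assume "\<forall>n\<in>coord X ` ?B. x' n = x n"
  then show "observe X F x' = observe X F x"
    unfolding observe_def read_bits_eq_iff using F by auto
qed

text \<open>The finitely many coordinates that determine \<open>h\<close> belong to finitely many factors.\<close>

lemma locally_constant_factors_observe:
  assumes X: "countable (dom X)" and h: "locally_constant (cantor X) h"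
  shows "\<exists>F\<in>FinLO (dom X). \<forall>x\<in>points X. \<forall>x'\<in>points X. observe X F x = observe X F x' \<longrightarrow> h x = h x'"
proof -
  obtain K where K: "finite K" "K \<subseteq> coords X" and
    h: "\<forall>x\<in>points X. \<forall>x'\<in>points X. (\<forall>n\<in>K. x' n = x n) \<longrightarrow> h x' = h x"
    using h unfolding locally_constant_two_pow_iff by (elim exE conjE)
  define F where "F = fst ` from_nat_into (bits X) ` K"
  have bit: "\<exists>i. from_nat_into (bits X) n = (j, i) \<and> j \<in> dom X \<and> i < the (X j) \<and> coord X (j, i) = n"
    if n: "n \<in> K" and j: "j = fst (from_nat_into (bits X) n)" for n j
  proof -
    obtain p where p: "p \<in> bits X" "n = coord X p"
      using n K(2) unfolding coords_def by blast
    then have "from_nat_into (bits X) n = p"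
      unfolding coord_def using countable_bits[OF X] by simp
    then show ?thesis using p j unfolding bits_def by auto
  qed
  have "F \<in> FinLO (dom X)"
    unfolding FinLO_def F_def using K(1) bit by blast
  moreover have "h x = h x'"
    if x: "x \<in> points X" "x' \<in> points X" and eq: "observe X F x = observe X F x'" for x x'
  proof -
    have finF: "finite F" unfolding F_def using K(1) by blast
    have eq: "x (coord X (j, i)) = x' (coord X (j, i))" if "j \<in> F" "i < the (X j)" for i j
      using eq that finF unfolding observe_def read_bits_eq_iff by simp
    have "x n = x' n" if n: "n \<in> K" for n
    proof -
      obtain j i where ji: "from_nat_into (bits X) n = (j, i)" "i < the (X j)" "coord X (j, i) = n"
        using bit[OF n refl] by blast
      have "j \<in> F" unfolding F_def using n ji(1) by force
      then show ?thesis using eq[of j i] ji by simp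
    qed
    then show "h x = h x'" using h[rule_format, OF x(2,1)] by simp
  qed
  ultimately show ?thesis by blast
qed

lemma filter_sorted_list_of_set:
  assumes "finite F'" "F \<subseteq> F'"
  shows "filter (\<lambda>i. i \<in> F) (sorted_list_of_set F') = sorted_list_of_set (F :: 'j::linorder set)"
  using assms finite_subset[OF assms(2,1)]
  by (intro sorted_distinct_set_unique) (auto simp: sorted_wrt_filter)

lemma proj_BinStoch:
  assumes "F \<subseteq> F'" "finite F'"
  obtains \<phi> where "\<phi> \<in> bin_pow (dimension X F') \<rightarrow> bin_pow (dimension X F)"
    "proj BinStoch X F' F = det_matrix (dimension X F') (dimension X F) \<phi>"
    "\<And>x. \<phi> (observe X F' x) = observe X F x"
proof
  note f = filter_sorted_list_of_set[OF assms(2,1)]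
  show "keep X F (sorted_list_of_set F') \<in> bin_pow (dimension X F') \<rightarrow> bin_pow (dimension X F)"
    using keep_bin_pow[of X F "sorted_list_of_set F'"] unfolding f tensor_over_def .
  show "proj BinStoch X F' F = det_matrix (dimension X F') (dimension X F) (keep X F (sorted_list_of_set F'))"
    unfolding proj_def proj_list_BinStoch f tensor_over_def ..
  show "keep X F (sorted_list_of_set F') (observe X F' x) = observe X F x" for x
    unfolding observe_def keep_read_bits f ..
qed

lemma proj_hom:
  "F \<subseteq> F' \<Longrightarrow> finite F' \<Longrightarrow> proj BinStoch X F' F \<in> hom BinStoch (dimension X F') (dimension X F)"
  by (metis proj_BinStoch det_matrix_hom)

lemma act_proj:
  assumes "F \<subseteq> F'" "finite F'"
  shows "act (proj BinStoch X F' F) y (observe X F' x) = (if y = observe X F x then 1 else 0)"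
proof -
  obtain \<phi> where "proj BinStoch X F' F = det_matrix (dimension X F') (dimension X F) \<phi>"
    "\<And>x. \<phi> (observe X F' x) = observe X F x"
    using proj_BinStoch[OF assms] by metis
  then show ?thesis by (simp add: det_matrix_def observe_bin_pow)
qed

definition cylinder :: "('j::linorder \<rightharpoonup> nat) \<Rightarrow> 'j set \<Rightarrow> bool list \<Rightarrow> (nat \<Rightarrow> bool) set" where
  "cylinder X F y = {x \<in> points X. observe X F x = y}"

lemma cylinder_Clopen: "F \<in> FinLO (dom X) \<Longrightarrow> cylinder X F y \<in> Clopen (cantor X)"
  using Clopen_fibre[OF locally_constant_observe[of F X]] unfolding cylinder_def topspace_two_pow .

lemma act_Comp_proj_right:
  assumes F: "F \<subseteq> F'" "finite F'" and f: "f \<in> hom BinStoch (dimension X F) n"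
  shows "act (Comp BinStoch f (proj BinStoch X F' F)) z (observe X F' x) = act f z (observe X F x)"
proof -
  obtain k where k: "f = Arr (dimension X F) n k"
    using f unfolding hom_BinStoch by blast
  obtain \<phi> where \<phi>: "\<phi> \<in> bin_pow (dimension X F') \<rightarrow> bin_pow (dimension X F)"
    "proj BinStoch X F' F = det_matrix (dimension X F') (dimension X F) \<phi>"
    "\<phi> (observe X F' x) = observe X F x"
    using proj_BinStoch[OF F] by metis
  show ?thesis
    unfolding \<phi>(2) k using Comp_det_matrix_right[OF \<phi>(1) observe_bin_pow] by (simp add: \<phi>(3))
qed

text \<open>Projecting the output sums over all words of \<open>Y\<^sub>G\<^sub>'\<close> that restrict to \<open>y\<close>; these are the words
  observed on the cylinder over \<open>y\<close>.\<close>

lemma act_Comp_proj_left: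
  assumes Y: "countable (dom Y)" and G: "G \<subseteq> G'" "G' \<in> FinLO (dom Y)"
    and f: "f \<in> hom BinStoch m (dimension Y G')"
  shows "act (Comp BinStoch (proj BinStoch Y G' G) f) y a =
    (\<Sum>y'\<in>observe Y G' ` cylinder Y G y. act f y' a)"
proof -
  have fin: "finite G'" using G(2) unfolding FinLO_def by simp
  obtain k where k: "f = Arr m (dimension Y G') k"
    using f unfolding hom_BinStoch by blast
  obtain \<phi> where \<phi>: "proj BinStoch Y G' G = det_matrix (dimension Y G') (dimension Y G) \<phi>"
    "\<And>x. \<phi> (observe Y G' x) = observe Y G x"
    using proj_BinStoch[OF G(1) fin] by metis
  have "{y'. y' \<in> bin_pow (dimension Y G') \<and> \<phi> y' = y} = observe Y G' ` cylinder Y G y"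
    unfolding cylinder_def observe_image[OF Y G(2), symmetric] using \<phi>(2) by auto
  then show ?thesis
    unfolding \<phi>(1) k Comp_det_matrix_left by simp
qed

text \<open>Membership in \<open>U\<close> can be read off the observation of \<open>F\<close>: \<open>U\<close> is a union of cylinders over \<open>F\<close>.\<close>

definition saturated :: "('j::linorder \<rightharpoonup> nat) \<Rightarrow> 'j set \<Rightarrow> (nat \<Rightarrow> bool) set \<Rightarrow> bool" where
  "saturated X F U \<longleftrightarrow>
    U \<subseteq> points X \<and> (\<forall>x\<in>U. \<forall>x'\<in>points X. observe X F x' = observe X F x \<longrightarrow> x' \<in> U)"

lemma saturated_mono:
  assumes "saturated X F U" "F \<subseteq> F'" "finite F'"
  shows "saturated X F' U"
  using assms(1) observe_mono[OF assms(2,3)] unfolding saturated_def by blast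

lemma saturated_cylinder: "saturated X F (cylinder X F y)"
  unfolding saturated_def cylinder_def by auto

lemma saturated_points: "saturated X F (points X)"
  unfolding saturated_def by auto

lemma saturated_Un: "saturated X F U \<Longrightarrow> saturated X F V \<Longrightarrow> saturated X F (U \<union> V)"
  unfolding saturated_def by blast

lemma Clopen_saturated:
  assumes X: "countable (dom X)" and U: "U \<in> Clopen (cantor X)"
  shows "\<exists>F\<in>FinLO (dom X). saturated X F U"
proof -
  obtain F where "F \<in> FinLO (dom X)"
    "\<forall>x\<in>points X. \<forall>x'\<in>points X. observe X F x = observe X F x' \<longrightarrow> (x \<in> U) = (x' \<in> U)"
    using locally_constant_factors_observe[OF X locally_constant_Clopen[OF U]] by blast
  then show ?thesis
    unfolding saturated_def using Clopen_subset[OF U] topspace_two_pow[of "coords X"] by (metis subsetD)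
qed

lemma fin_add_prob_saturated:
  assumes m: "fin_add_prob (cantor X) m" and F: "F \<in> FinLO (dom X)" and U: "saturated X F U"
  shows "m U = (\<Sum>y\<in>observe X F ` U. m (cylinder X F y))"
proof -
  have "observe X F ` U \<subseteq> bin_pow (dimension X F)"
    using observe_bin_pow by blast
  then have fin: "finite (observe X F ` U)"
    using finite_bin_pow finite_subset by blast
  have "U = {x \<in> topspace (cantor X). observe X F x \<in> observe X F ` U}"
    using U unfolding saturated_def topspace_two_pow by auto
  then show ?thesis
    using fin_add_prob_sum_fibres[OF m locally_constant_observe[OF F] fin]
    unfolding cylinder_def topspace_two_pow by simp
qed

section \<open>Finite approximation families and kernels\<close>

abbreviation is_family :: "('j::linorder \<rightharpoonup> nat) \<Rightarrow> ('j \<rightharpoonup> nat) \<Rightarrow>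
    ('j, (nat, bool list \<Rightarrow> bool list \<Rightarrow> real) arr) family \<Rightarrow> bool" where
  "is_family \<equiv> finite_approximation_family BinStoch"

text \<open>The relation behind the equivalence: the matrices of \<open>f\<close> list the values of \<open>k\<close> on cylinders.\<close>

definition represents :: "('j::linorder \<rightharpoonup> nat) \<Rightarrow> ('j \<rightharpoonup> nat) \<Rightarrow>
    ('j, (nat, bool list \<Rightarrow> bool list \<Rightarrow> real) arr) family \<Rightarrow>
    ((nat \<Rightarrow> bool) set \<Rightarrow> (nat \<Rightarrow> bool) \<Rightarrow> real) \<Rightarrow> bool" where
  "represents X Y f k \<longleftrightarrow> (\<forall>(F, G)\<in>dom f. \<forall>y\<in>bin_pow (dimension Y G). \<forall>x\<in>points X.
     act (the (f (F, G))) y (observe X F x) = k (cylinder Y G y) x)"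

lemma representsD:
  "represents X Y f k \<Longrightarrow> (F, G) \<in> dom f \<Longrightarrow> y \<in> bin_pow (dimension Y G) \<Longrightarrow> x \<in> points X \<Longrightarrow>
    act (the (f (F, G))) y (observe X F x) = k (cylinder Y G y) x"
  unfolding represents_def by blast

lemma family_FinLO:
  "is_family X Y f \<Longrightarrow> (F, G) \<in> dom f \<Longrightarrow> F \<in> FinLO (dom X) \<and> G \<in> FinLO (dom Y)"
  unfolding finite_approximation_family_def by (elim conjE) (drule (1) subsetD, simp)

lemma family_hom:
  "is_family X Y f \<Longrightarrow> (F, G) \<in> dom f \<Longrightarrow>
    the (f (F, G)) \<in> hom BinStoch (dimension X F) (dimension Y G)"
  unfolding finite_approximation_family_def by (elim conjE allE) (erule (1) mp)

lemma family_natural: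
  assumes "is_family X Y f" "(F, G) \<in> dom f" "(F', G') \<in> dom f" "F \<subseteq> F'" "G \<subseteq> G'"
  shows "Comp BinStoch (proj BinStoch Y G' G) (the (f (F', G'))) =
    Comp BinStoch (the (f (F, G))) (proj BinStoch X F' F)"
  using assms(1)[unfolded finite_approximation_family_def, THEN conjunct2, THEN conjunct2, THEN conjunct1,
      rule_format, OF conjI[OF assms(2) conjI[OF assms(3) conjI[OF assms(4,5)]]]] .

lemma family_covering:
  "is_family X Y f \<Longrightarrow> G \<in> FinLO (dom Y) \<Longrightarrow> \<exists>F. (F, G) \<in> dom f"
  unfolding finite_approximation_family_def by (elim conjE) (erule (1) bspec)

lemma family_hereditary:
  assumes "is_family X Y f" "(F, G) \<in> dom f" "F \<subseteq> F'" "F' \<in> FinLO (dom X)"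
  shows "(F', G) \<in> dom f"
  using assms(1)[unfolded finite_approximation_family_def, THEN conjunct2, THEN conjunct2, THEN conjunct2,
      THEN conjunct2, rule_format, OF assms(2,4,3)] .

text \<open>Covering provides some index \<open>F\<close> for \<open>G \<union> G'\<close>, and hereditariness enlarges it.\<close>

lemma family_common:
  assumes f: "is_family X Y f" and "(F, G) \<in> dom f" "(F', G') \<in> dom f"
  shows "\<exists>F''. F \<subseteq> F'' \<and> F' \<subseteq> F'' \<and> (F'', G \<union> G') \<in> dom f"
proof -
  note FG = family_FinLO[OF f assms(2)] family_FinLO[OF f assms(3)]
  have "G \<union> G' \<in> FinLO (dom Y)" using FG FinLO_Un by blast
  then obtain F'' where F'': "(F'', G \<union> G') \<in> dom f"
    using family_covering[OF f] by blast
  have "F'' \<union> (F \<union> F') \<in> FinLO (dom X)"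
    using FG family_FinLO[OF f F''] FinLO_Un by blast
  then have "(F'' \<union> (F \<union> F'), G \<union> G') \<in> dom f"
    using family_hereditary[OF f F''] by blast
  moreover have "F \<subseteq> F'' \<union> (F \<union> F')" "F' \<subseteq> F'' \<union> (F \<union> F')" by auto
  ultimately show ?thesis by metis
qed

lemma represents_saturated:
  assumes r: "represents X Y f k" and k: "lc_kernel (cantor X) (cantor Y) k"
    and FG: "(F, G) \<in> dom f" and G: "G \<in> FinLO (dom Y)" and U: "saturated Y G U" and x: "x \<in> points X"
  shows "k U x = (\<Sum>y\<in>observe Y G ` U. act (the (f (F, G))) y (observe X F x))"
proof -
  have "fin_add_prob (cantor Y) (\<lambda>U. k U x)"
    using lc_kernelD(2)[OF k] x unfolding topspace_two_pow by blast
  then have "k U x = (\<Sum>y\<in>observe Y G ` U. k (cylinder Y G y) x)"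
    by (rule fin_add_prob_saturated[OF _ G U])
  also have "\<dots> = (\<Sum>y\<in>observe Y G ` U. act (the (f (F, G))) y (observe X F x))"
    by (intro sum.cong refl) (auto simp: representsD[OF r FG _ x] observe_bin_pow)
  finally show ?thesis .
qed

text \<open>Naturality comes for free: both composites list the values of \<open>k\<close> on cylinders over the smaller \<open>G\<close>,
  and matrices are determined by their entries at observed words, since every word is observed
  at some point.\<close>

lemma family_if_represents:
  assumes X: "countable (dom X)" and Y: "countable (dom Y)"
    and sub: "dom f \<subseteq> FinLO (dom X) \<times> FinLO (dom Y)"
    and hom: "\<And>F G. (F, G) \<in> dom f \<Longrightarrow> the (f (F, G)) \<in> hom BinStoch (dimension X F) (dimension Y G)"
    and covering: "\<And>G. G \<in> FinLO (dom Y) \<Longrightarrow> \<exists>F. (F, G) \<in> dom f"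
    and hereditary: "\<And>F G F'. (F, G) \<in> dom f \<Longrightarrow> F' \<in> FinLO (dom X) \<Longrightarrow> F \<subseteq> F' \<Longrightarrow> (F', G) \<in> dom f"
    and k: "lc_kernel (cantor X) (cantor Y) k" and r: "represents X Y f k"
  shows "is_family X Y f"
proof -
  have "Comp BinStoch (proj BinStoch Y G' G) (the (f (F', G'))) =
      Comp BinStoch (the (f (F, G))) (proj BinStoch X F' F)"
    if FG: "(F, G) \<in> dom f" and FG': "(F', G') \<in> dom f" and le: "F \<subseteq> F'" "G \<subseteq> G'" for F G F' G'
  proof (rule hom_BinStoch_eqI)
    have F': "F' \<in> FinLO (dom X)" "finite F'" and G': "G' \<in> FinLO (dom Y)" "finite G'"
      using sub FG' unfolding FinLO_def by auto
    show "Comp BinStoch (proj BinStoch Y G' G) (the (f (F', G'))) \<in> hom BinStoch (dimension X F') (dimension Y G)"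
      using Comp_hom_BinStoch[OF hom[OF FG'] proj_hom[OF le(2) G'(2)]] .
    show "Comp BinStoch (the (f (F, G))) (proj BinStoch X F' F) \<in> hom BinStoch (dimension X F') (dimension Y G)"
      using Comp_hom_BinStoch[OF proj_hom[OF le(1) F'(2)] hom[OF FG]] .
    fix y a assume y: "y \<in> bin_pow (dimension Y G)" and "a \<in> bin_pow (dimension X F')"
    then obtain x where x: "x \<in> points X" and a: "a = observe X F' x"
      unfolding observe_image[OF X F'(1), symmetric] by blast
    have "act (Comp BinStoch (proj BinStoch Y G' G) (the (f (F', G')))) y a =
        (\<Sum>y'\<in>observe Y G' ` cylinder Y G y. act (the (f (F', G'))) y' (observe X F' x))"
      unfolding a by (rule act_Comp_proj_left[OF Y le(2) G'(1) hom[OF FG']])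
    also have "\<dots> = k (cylinder Y G y) x"
      using represents_saturated[OF r k FG' G'(1) saturated_mono[OF saturated_cylinder le(2) G'(2)] x] ..
    also have "\<dots> = act (Comp BinStoch (the (f (F, G))) (proj BinStoch X F' F)) y a"
      unfolding a act_Comp_proj_right[OF le(1) F'(2) hom[OF FG]] using representsD[OF r FG y x] ..
    finally show "act (Comp BinStoch (proj BinStoch Y G' G) (the (f (F', G')))) y a =
      act (Comp BinStoch (the (f (F, G))) (proj BinStoch X F' F)) y a" .
  qed
  note natural = this
  show ?thesis
    unfolding finite_approximation_family_def
  proof (intro conjI allI impI ballI)
    fix F G F' G'
    assume "(F, G) \<in> dom f \<and> (F', G') \<in> dom f \<and> F \<subseteq> F' \<and> G \<subseteq> G'"
    then show "Comp BinStoch (proj BinStoch Y G' G) (the (f (F', G'))) =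
      Comp BinStoch (the (f (F, G))) (proj BinStoch X F' F)"
      by (elim conjE) (rule natural)
  qed (fact sub hom covering hereditary)+
qed

subsection \<open>From families to kernels\<close>

text \<open>The value at \<open>U\<close> and \<open>x\<close> that the matrix with index \<open>(F, G)\<close> dictates, when \<open>U\<close> is a union of cylinders
  over \<open>G\<close>.\<close>

definition family_value :: "('j::linorder \<rightharpoonup> nat) \<Rightarrow> ('j \<rightharpoonup> nat) \<Rightarrow>
    ('j, (nat, bool list \<Rightarrow> bool list \<Rightarrow> real) arr) family \<Rightarrow> 'j set \<Rightarrow> 'j set \<Rightarrow>
    (nat \<Rightarrow> bool) set \<Rightarrow> (nat \<Rightarrow> bool) \<Rightarrow> real" where
  "family_value X Y f F G U x = (\<Sum>y\<in>observe Y G ` U. act (the (f (F, G))) y (observe X F x))"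

lemma finite_observe_image: "finite (observe X F ` U)"
proof -
  have "observe X F ` U \<subseteq> bin_pow (dimension X F)" using observe_bin_pow by blast
  then show ?thesis using finite_bin_pow finite_subset by blast
qed

text \<open>Naturality, summed over the words observed on \<open>U\<close>: grouping the words of \<open>Y\<^sub>G\<^sub>'\<close> by their restriction
  to \<open>G\<close> turns the sum for \<open>G'\<close> into the sum for \<open>G\<close>.\<close>

lemma family_value_mono:
  assumes Y: "countable (dom Y)" and f: "is_family X Y f"
    and FG: "(F, G) \<in> dom f" and FG': "(F', G') \<in> dom f" and le: "F \<subseteq> F'" "G \<subseteq> G'"
    and U: "saturated Y G U"
  shows "family_value X Y f F' G' U x = family_value X Y f F G U x"
proof -
  have F': "finite F'" and G': "G' \<in> FinLO (dom Y)" "finite G'"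
    using family_FinLO[OF f FG'] unfolding FinLO_def by auto
  let ?E = "\<lambda>y. observe Y G' ` cylinder Y G y"
  have "(\<Union>y\<in>observe Y G ` U. cylinder Y G y) = U"
    using U unfolding saturated_def cylinder_def by auto
  then have UN: "(\<Union>y\<in>observe Y G ` U. ?E y) = observe Y G' ` U" by (metis image_UN)
  have disj: "?E y \<inter> ?E y' = {}" if "y \<noteq> y'" for y y'
    using that observe_mono[OF le(2) G'(2)] unfolding cylinder_def by blast
  have "family_value X Y f F G U x =
      (\<Sum>y\<in>observe Y G ` U. act (Comp BinStoch (the (f (F, G))) (proj BinStoch X F' F)) y (observe X F' x))"
    unfolding family_value_def act_Comp_proj_right[OF le(1) F' family_hom[OF f FG]] ..
  also have "\<dots> = (\<Sum>y\<in>observe Y G ` U. \<Sum>y'\<in>?E y. act (the (f (F', G'))) y' (observe X F' x))"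
    unfolding family_natural[OF f FG FG' le, symmetric]
      act_Comp_proj_left[OF Y le(2) G'(1) family_hom[OF f FG']] ..
  also have "\<dots> = family_value X Y f F' G' U x"
    unfolding family_value_def UN[symmetric]
    by (rule sum.UNION_disjoint[symmetric]) (use finite_observe_image disj in auto)
  finally show ?thesis ..
qed

lemma family_value_unique:
  assumes Y: "countable (dom Y)" and f: "is_family X Y f"
    and FG: "(F, G) \<in> dom f" "saturated Y G U" and FG': "(F', G') \<in> dom f" "saturated Y G' U"
  shows "family_value X Y f F G U x = family_value X Y f F' G' U x"
proof -
  obtain F'' where F'': "F \<subseteq> F''" "F' \<subseteq> F''" "(F'', G \<union> G') \<in> dom f"
    using family_common[OF f FG(1) FG'(1)] by blast
  show ?thesis
    using family_value_mono[OF Y f FG(1) F''(3,1) Un_upper1 FG(2)]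
      family_value_mono[OF Y f FG'(1) F''(3,2) Un_upper2 FG'(2)] by simp
qed

text \<open>Any admissible index \<open>(F, G)\<close> gives the same value, by \<open>family_value_unique\<close>.\<close>

definition family_kernel :: "('j::linorder \<rightharpoonup> nat) \<Rightarrow> ('j \<rightharpoonup> nat) \<Rightarrow>
    ('j, (nat, bool list \<Rightarrow> bool list \<Rightarrow> real) arr) family \<Rightarrow>
    (nat \<Rightarrow> bool) set \<Rightarrow> (nat \<Rightarrow> bool) \<Rightarrow> real" where
  "family_kernel X Y f U x =
    (if U \<in> Clopen (cantor Y) \<and> x \<in> points X
     then SOME v. \<exists>F G. (F, G) \<in> dom f \<and> saturated Y G U \<and> v = family_value X Y f F G U x
     else 0)"

lemma family_kernel_eq:
  assumes Y: "countable (dom Y)" and f: "is_family X Y f"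
    and FG: "(F, G) \<in> dom f" "saturated Y G U" and U: "U \<in> Clopen (cantor Y)" and x: "x \<in> points X"
  shows "family_kernel X Y f U x = family_value X Y f F G U x"
proof -
  let ?P = "\<lambda>v. \<exists>F G. (F, G) \<in> dom f \<and> saturated Y G U \<and> v = family_value X Y f F G U x"
  have "?P (SOME v. ?P v)"
    by (rule someI) (use FG in blast)
  then have "(SOME v. ?P v) = family_value X Y f F G U x"
    using family_value_unique[OF Y f _ _ FG] by (elim exE conjE) simp
  then show ?thesis
    unfolding family_kernel_def using U x by simp
qed

text \<open>For fixed \<open>U\<close> a single index \<open>(F, G)\<close> computes the value at all \<open>x\<close>, which shows local constancy; for
  additivity one \<open>G\<close> is taken that resolves both sets.\<close>

lemma lc_kernel_family_kernel:
  assumes Y: "countable (dom Y)" and f: "is_family X Y f"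
  shows "lc_kernel (cantor X) (cantor Y) (family_kernel X Y f)"
proof (rule lc_kernelI)
  fix U assume U: "U \<in> Clopen (cantor Y)"
  then obtain G where G: "G \<in> FinLO (dom Y)" "saturated Y G U"
    using Clopen_saturated[OF Y] by blast
  then obtain F where F: "(F, G) \<in> dom f"
    using family_covering[OF f] by blast
  have "F \<in> FinLO (dom X)" using family_FinLO[OF f F] by blast
  then show "locally_constant (cantor X) (family_kernel X Y f U)"
    by (rule locally_constant_map[OF locally_constant_observe])
      (simp add: topspace_two_pow family_kernel_eq[OF Y f F G(2) U] family_value_def)
next
  fix x assume "x \<in> topspace (cantor X)"
  then have x: "x \<in> points X" unfolding topspace_two_pow .
  have st: "stochastic (dimension X F) (dimension Y G) (act (the (f (F, G))))" if "(F, G) \<in> dom f" for F G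
    using family_hom[OF f that] unfolding hom_BinStoch by (metis arr.sel(3))
  show "fin_add_prob (cantor Y) (\<lambda>U. family_kernel X Y f U x)"
    unfolding fin_add_prob_def
  proof (intro conjI ballI impI)
    fix U assume U: "U \<in> Clopen (cantor Y)"
    then obtain G where G: "G \<in> FinLO (dom Y)" "saturated Y G U"
      using Clopen_saturated[OF Y] by blast
    then obtain F where F: "(F, G) \<in> dom f"
      using family_covering[OF f] by blast
    show "0 \<le> family_kernel X Y f U x"
      unfolding family_kernel_eq[OF Y f F G(2) U x] family_value_def
      by (rule sum_nonneg) (use st[OF F] in \<open>simp add: stochastic_def\<close>)
  next
    \<comment> \<open>The whole space is a union of cylinders over every \<open>G\<close>; the empty index suffices.\<close>
    have G: "{} \<in> FinLO (dom Y)" unfolding FinLO_def by simp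
    then obtain F where F: "(F, {}) \<in> dom f"
      using family_covering[OF f] by blast
    have "points Y \<in> Clopen (cantor Y)"
      using Clopen_topspace[of "cantor Y"] unfolding topspace_two_pow .
    then have "family_kernel X Y f (points Y) x =
        (\<Sum>y\<in>bin_pow (dimension Y {}). act (the (f (F, {}))) y (observe X F x))"
      using family_kernel_eq[OF Y f F saturated_points _ x]
      unfolding family_value_def observe_image[OF Y G] by blast
    also have "\<dots> = 1"
      using st[OF F] observe_bin_pow unfolding stochastic_def by blast
    finally show "family_kernel X Y f (topspace (cantor Y)) x = 1"
      unfolding topspace_two_pow .
  next
    fix U V assume U: "U \<in> Clopen (cantor Y)" and V: "V \<in> Clopen (cantor Y)" and UV: "U \<inter> V = {}"
    obtain G1 G2 where G1: "G1 \<in> FinLO (dom Y)" "saturated Y G1 U"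
      and G2: "G2 \<in> FinLO (dom Y)" "saturated Y G2 V"
      using Clopen_saturated[OF Y] U V by metis
    define G where "G = G1 \<union> G2"
    have G: "G \<in> FinLO (dom Y)" "finite G"
      using G1(1) G2(1) unfolding G_def FinLO_def by auto
    then obtain F where F: "(F, G) \<in> dom f"
      using family_covering[OF f] by blast
    have sU: "saturated Y G U" and sV: "saturated Y G V"
      using saturated_mono[OF G1(2) _ G(2)] saturated_mono[OF G2(2) _ G(2)] unfolding G_def by auto
    have "observe Y G ` U \<inter> observe Y G ` V = {}"
      using sU sV UV unfolding saturated_def by blast
    then have "family_value X Y f F G (U \<union> V) x = family_value X Y f F G U x + family_value X Y f F G V x"
      unfolding family_value_def image_Un by (rule sum.union_disjoint[OF finite_observe_image finite_observe_image])
    then show "family_kernel X Y f (U \<union> V) x = family_kernel X Y f U x + family_kernel X Y f V x"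
      using family_kernel_eq[OF Y f F sU U x] family_kernel_eq[OF Y f F sV V x]
        family_kernel_eq[OF Y f F saturated_Un[OF sU sV] Clopen_Un[OF U V] x] by simp
  qed
qed (auto simp: family_kernel_def topspace_two_pow)

lemma observe_image_cylinder:
  assumes "countable (dom X)" "F \<in> FinLO (dom X)" "y \<in> bin_pow (dimension X F)"
  shows "observe X F ` cylinder X F y = {y}"
proof -
  obtain x where "x \<in> points X" "y = observe X F x"
    using assms(3) unfolding observe_image[OF assms(1,2), symmetric] by blast
  then show ?thesis unfolding cylinder_def by auto
qed

lemma represents_family_kernel:
  assumes Y: "countable (dom Y)" and f: "is_family X Y f"
  shows "represents X Y f (family_kernel X Y f)"
  unfolding represents_def
proof (intro ballI, clarify)
  fix F G y x m assume "f (F, G) = Some m" and y: "y \<in> bin_pow (dimension Y G)" and x: "x \<in> points X"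
  then have FG: "(F, G) \<in> dom f" by blast
  then have G: "G \<in> FinLO (dom Y)" using family_FinLO[OF f] by blast
  show "act (the (f (F, G))) y (observe X F x) = family_kernel X Y f (cylinder Y G y) x"
    unfolding family_kernel_eq[OF Y f FG saturated_cylinder cylinder_Clopen[OF G] x]
      family_value_def observe_image_cylinder[OF Y G y] by simp
qed

subsection \<open>From kernels to families\<close>

text \<open>The largest possible index set is used: all \<open>(F, G)\<close> such that the values of \<open>k\<close> on cylinders over \<open>G\<close>
  depend on the observation of \<open>F\<close> only. It is covering because the finitely many functions
  \<open>k (cylinder Y G y)\<close> are locally constant and hence factor through one common observation.\<close>

lemma kernel_represented:
  assumes X: "countable (dom X)" and Y: "countable (dom Y)"
    and k: "lc_kernel (cantor X) (cantor Y) k"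
  shows "\<exists>f. is_family X Y f \<and> represents X Y f k"
proof -
  define factors where "factors F G \<longleftrightarrow> F \<in> FinLO (dom X) \<and> G \<in> FinLO (dom Y) \<and>
    (\<forall>y\<in>bin_pow (dimension Y G). \<forall>x\<in>points X. \<forall>x'\<in>points X.
       observe X F x = observe X F x' \<longrightarrow> k (cylinder Y G y) x = k (cylinder Y G y) x')" for F G
  \<comment> \<open>Some point at which the word \<open>a\<close> is observed; for an index in the family the matrix entry is independent of the choice.\<close>
  define point where "point F a = (SOME x. x \<in> points X \<and> observe X F x = a)" for F a
  define mat where "mat F G y a =
    (if y \<in> bin_pow (dimension Y G) \<and> a \<in> bin_pow (dimension X F)
     then k (cylinder Y G y) (point F a) else 0)" for F G y a
  define f where "f = (\<lambda>(F, G). if factors F G then Some (Arr (dimension X F) (dimension Y G) (mat F G)) else None)"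
  have dom: "(F, G) \<in> dom f \<longleftrightarrow> factors F G" for F G
    unfolding f_def by (auto split: if_splits)
  have val: "the (f (F, G)) = Arr (dimension X F) (dimension Y G) (mat F G)" if "(F, G) \<in> dom f" for F G
    using that unfolding dom by (simp add: f_def)
  have point: "point F a \<in> points X" "observe X F (point F a) = a"
    if "F \<in> FinLO (dom X)" "a \<in> bin_pow (dimension X F)" for F a
  proof -
    have "a \<in> observe X F ` points X"
      using that(2) unfolding observe_image[OF X that(1)] .
    then have "\<exists>x. x \<in> points X \<and> observe X F x = a" by blast
    then have "point F a \<in> points X \<and> observe X F (point F a) = a"
      unfolding point_def by (rule someI_ex)
    then show "point F a \<in> points X" "observe X F (point F a) = a" by blast+
  qed
  have fap: "fin_add_prob (cantor Y) (\<lambda>U. k U x)" if "x \<in> points X" for x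
    using lc_kernelD(2)[OF k] that unfolding topspace_two_pow by blast
  have r: "represents X Y f k"
    unfolding represents_def
  proof (intro ballI, clarify)
    fix F G y x m assume "f (F, G) = Some m" and y: "y \<in> bin_pow (dimension Y G)" and x: "x \<in> points X"
    then have FG: "(F, G) \<in> dom f" by blast
    then have fac: "factors F G" unfolding dom .
    then have "F \<in> FinLO (dom X)" unfolding factors_def by blast
    note p = point[OF this observe_bin_pow, of x]
    have "k (cylinder Y G y) (point F (observe X F x)) = k (cylinder Y G y) x"
      using fac y x p unfolding factors_def by blast
    then show "act (the (f (F, G))) y (observe X F x) = k (cylinder Y G y) x"
      unfolding val[OF FG] mat_def using y by (simp add: observe_bin_pow)
  qed
  have "is_family X Y f"
  proof (rule family_if_represents[OF X Y _ _ _ _ k r])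
    show "dom f \<subseteq> FinLO (dom X) \<times> FinLO (dom Y)"
      using dom unfolding factors_def by auto
  next
    fix F G assume FG: "(F, G) \<in> dom f"
    have F: "F \<in> FinLO (dom X)" and G: "G \<in> FinLO (dom Y)"
      using FG dom unfolding factors_def by blast+
    have "stochastic (dimension X F) (dimension Y G) (mat F G)"
      unfolding stochastic_def
    proof (intro conjI allI ballI impI)
      fix y a
      show "0 \<le> mat F G y a"
        unfolding mat_def using fin_add_prob_nonneg[OF fap[OF point(1)[OF F]] cylinder_Clopen[OF G]] by simp
      assume "\<not> (y \<in> bin_pow (dimension Y G) \<and> a \<in> bin_pow (dimension X F))"
      then show "mat F G y a = 0"
        unfolding mat_def by (rule if_not_P)
    next
      fix a assume a: "a \<in> bin_pow (dimension X F)"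
      have "k (points Y) (point F a) = (\<Sum>y\<in>bin_pow (dimension Y G). k (cylinder Y G y) (point F a))"
        using fin_add_prob_saturated[OF fap[OF point(1)[OF F a]] G saturated_points]
        unfolding observe_image[OF Y G] .
      then show "(\<Sum>y\<in>bin_pow (dimension Y G). mat F G y a) = 1"
        using fin_add_prob_topspace[OF fap[OF point(1)[OF F a]]] a
        unfolding mat_def topspace_two_pow by simp
    qed
    then show "the (f (F, G)) \<in> hom BinStoch (dimension X F) (dimension Y G)"
      unfolding val[OF FG] hom_BinStoch by blast
  next
    fix G assume G: "G \<in> FinLO (dom Y)"
    let ?B = "bin_pow (dimension Y G)"
    let ?q = "\<lambda>x. \<lambda>y\<in>?B. k (cylinder Y G y) x"
    have "locally_constant (cantor X) ?q"
      by (intro locally_constant_family finite_bin_pow lc_kernelD(1)[OF k] cylinder_Clopen[OF G])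
    then obtain F where F: "F \<in> FinLO (dom X)"
      "\<forall>x\<in>points X. \<forall>x'\<in>points X. observe X F x = observe X F x' \<longrightarrow> ?q x = ?q x'"
      using locally_constant_factors_observe[OF X] by blast
    have "k (cylinder Y G y) x = k (cylinder Y G y) x'"
      if "y \<in> ?B" "x \<in> points X" "x' \<in> points X" "observe X F x = observe X F x'" for x x' y
    proof -
      have "?q x y = ?q x' y" using F(2)[rule_format, OF that(2-4)] by (rule fun_cong)
      then show ?thesis using that(1) by simp
    qed
    then have "factors F G" unfolding factors_def using F(1) G by blast
    then show "\<exists>F. (F, G) \<in> dom f" unfolding dom ..
  next
    fix F G F' assume "(F, G) \<in> dom f" and F': "F' \<in> FinLO (dom X)" "F \<subseteq> F'"
    then have fac: "factors F G" unfolding dom by blast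
    have fin: "finite F'" using F'(1) unfolding FinLO_def by simp
    have "factors F' G"
      unfolding factors_def
    proof (intro conjI ballI impI)
      fix y x x' assume *: "y \<in> bin_pow (dimension Y G)" "x \<in> points X" "x' \<in> points X"
        and "observe X F' x = observe X F' x'"
      then have "observe X F x = observe X F x'" using observe_mono[OF F'(2) fin] by blast
      then show "k (cylinder Y G y) x = k (cylinder Y G y) x'"
        using fac * unfolding factors_def by blast
    qed (use F' fac in \<open>auto simp: factors_def\<close>)
    then show "(F', G) \<in> dom f" unfolding dom .
  qed
  then show ?thesis using r by blast
qed

subsection \<open>Equivalence, identities and composition\<close>

text \<open>Equivalent families have a common index \<open>(F, G)\<close> for every \<open>G\<close>, and these indices already determine
  the kernel. Conversely the kernel determines every matrix, because every word is observed.\<close>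

lemma family_equiv_iff:
  assumes X: "countable (dom X)" and Y: "countable (dom Y)"
    and f: "is_family X Y f" "represents X Y f k" "lc_kernel (cantor X) (cantor Y) k"
    and f': "is_family X Y f'" "represents X Y f' k'" "lc_kernel (cantor X) (cantor Y) k'"
  shows "(f, f') \<in> family_equiv BinStoch X Y \<longleftrightarrow> k = k'"
proof
  assume "k = k'"
  have "f (F, G) = f' (F, G)" if FG: "(F, G) \<in> dom f" and FG': "(F, G) \<in> dom f'" for F G
  proof -
    have F: "F \<in> FinLO (dom X)" using family_FinLO[OF f(1) FG] by blast
    have "the (f (F, G)) = the (f' (F, G))"
    proof (rule hom_BinStoch_eqI[OF family_hom[OF f(1) FG] family_hom[OF f'(1) FG']])
      fix y a assume y: "y \<in> bin_pow (dimension Y G)" and "a \<in> bin_pow (dimension X F)"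
      then obtain x where x: "x \<in> points X" "a = observe X F x"
        unfolding observe_image[OF X F, symmetric] by blast
      show "act (the (f (F, G))) y a = act (the (f' (F, G))) y a"
        unfolding x(2) representsD[OF f(2) FG y x(1)] representsD[OF f'(2) FG' y x(1)] \<open>k = k'\<close> ..
    qed
    then show ?thesis using FG FG' by auto
  qed
  then show "(f, f') \<in> family_equiv BinStoch X Y"
    unfolding family_equiv_def using f(1) f'(1) by auto
next
  assume "(f, f') \<in> family_equiv BinStoch X Y"
  then have eq: "f (F, G) = f' (F, G)" if "(F, G) \<in> dom f" "(F, G) \<in> dom f'" for F G
    using that unfolding family_equiv_def by blast
  show "k = k'"
  proof (intro ext)
    fix U x
    show "k U x = k' U x"
    proof (cases "U \<in> Clopen (cantor Y) \<and> x \<in> points X")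
      case True
      then obtain G where G: "G \<in> FinLO (dom Y)" "saturated Y G U"
        using Clopen_saturated[OF Y] by blast
      obtain F F' where F: "(F, G) \<in> dom f" and F': "(F', G) \<in> dom f'"
        using family_covering[OF f(1) G(1)] family_covering[OF f'(1) G(1)] by blast
      have "F \<union> F' \<in> FinLO (dom X)"
        using family_FinLO[OF f(1) F] family_FinLO[OF f'(1) F'] FinLO_Un by blast
      then have d: "(F \<union> F', G) \<in> dom f" "(F \<union> F', G) \<in> dom f'"
        using family_hereditary[OF f(1) F Un_upper1] family_hereditary[OF f'(1) F' Un_upper2] by auto
      show ?thesis
        using represents_saturated[OF f(2,3) d(1) G, of x] represents_saturated[OF f'(2,3) d(2) G, of x]
          eq[OF d] True by simp
    next
      case False
      then show ?thesis
        using lc_kernelD(3)[OF f(3), of U x] lc_kernelD(3)[OF f'(3), of U x]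
        unfolding topspace_two_pow by simp
    qed
  qed
qed

text \<open>By \<open>family_equiv_iff\<close> the relation is the inverse image of equality under \<open>family_kernel\<close>.\<close>

lemma equiv_family_equiv:
  assumes X: "countable (dom X)" and Y: "countable (dom Y)"
  shows "equiv {f. is_family X Y f} (family_equiv BinStoch X Y)"
proof -
  have iff: "(f, g) \<in> family_equiv BinStoch X Y \<longleftrightarrow>
      is_family X Y f \<and> is_family X Y g \<and> family_kernel X Y f = family_kernel X Y g" for f g
  proof (cases "is_family X Y f \<and> is_family X Y g")
    case True
    then show ?thesis
      using family_equiv_iff[OF X Y _ represents_family_kernel[OF Y] lc_kernel_family_kernel[OF Y]
          _ represents_family_kernel[OF Y] lc_kernel_family_kernel[OF Y]] by blast
  qed (auto simp: family_equiv_def)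
  show ?thesis
    by (rule equivI) (auto simp: refl_on_def sym_def trans_def iff)
qed

lemma family_family_id:
  assumes X: "countable (dom X)"
  shows "is_family X X (family_id BinStoch X)" "represents X X (family_id BinStoch X) (kernel_id (cantor X))"
proof -
  let ?f = "family_id BinStoch X"
  have dom: "(F, G) \<in> dom ?f \<longleftrightarrow> F \<in> FinLO (dom X) \<and> G \<subseteq> F" for F G
    unfolding family_id_def by (auto split: if_splits)
  have val: "the (?f (F, G)) = proj BinStoch X F G" if "(F, G) \<in> dom ?f" for F G
    using that unfolding dom by (simp add: family_id_def)
  have fin: "finite F" "G \<in> FinLO (dom X)" if "(F, G) \<in> dom ?f" for F G
    using that finite_subset unfolding dom FinLO_def by auto
  show r: "represents X X ?f (kernel_id (cantor X))"
    unfolding represents_def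
  proof (intro ballI, clarify)
    fix F G y x m assume "?f (F, G) = Some m" and x: "x \<in> points X"
    then have FG: "(F, G) \<in> dom ?f" by blast
    then have "G \<subseteq> F" unfolding dom by blast
    show "act (the (?f (F, G))) y (observe X F x) = kernel_id (cantor X) (cylinder X G y) x"
      unfolding val[OF FG] act_proj[OF \<open>G \<subseteq> F\<close> fin(1)[OF FG]] kernel_id_def
      using cylinder_Clopen[OF fin(2)[OF FG], of y] x by (auto simp: cylinder_def)
  qed
  show "is_family X X ?f"
  proof (rule family_if_represents[OF X X _ _ _ _ lc_kernel_id r])
    show "dom ?f \<subseteq> FinLO (dom X) \<times> FinLO (dom X)"
      by (rule subrelI) (use dom fin(2) in blast)
    show "the (?f (F, G)) \<in> hom BinStoch (dimension X F) (dimension X G)" if "(F, G) \<in> dom ?f" for F G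
      unfolding val[OF that] using that proj_hom fin(1)[OF that] unfolding dom by blast
    show "\<exists>F. (F, G) \<in> dom ?f" if "G \<in> FinLO (dom X)" for G
      using that dom[of G G] by blast
    show "(F', G) \<in> dom ?f" if "(F, G) \<in> dom ?f" "F' \<in> FinLO (dom X)" "F \<subseteq> F'" for F G F'
      using that unfolding dom by blast
  qed
qed

text \<open>The matrix product for an intermediate index \<open>G\<close> is the integral of \<open>l (cylinder Z H z)\<close> computed along
  \<open>observe Y G\<close>. This value involves no \<open>G\<close>, so the description operator in \<open>family_comp\<close> is
  well defined, and it is the value of the composite kernel.\<close>

lemma family_family_comp:
  assumes X: "countable (dom X)" and Y: "countable (dom Y)" and Z: "countable (dom Z)"
    and f: "is_family X Y f" "represents X Y f k" "lc_kernel (cantor X) (cantor Y) k"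
    and g: "is_family Y Z g" "represents Y Z g l" "lc_kernel (cantor Y) (cantor Z) l"
  shows "is_family X Z (family_comp BinStoch g f)"
    and "represents X Z (family_comp BinStoch g f) (kernel_comp (cantor X) (cantor Y) (cantor Z) l k)"
proof -
  let ?h = "family_comp BinStoch g f" and ?K = "kernel_comp (cantor X) (cantor Y) (cantor Z) l k"
  let ?c = "\<lambda>F G H. Comp BinStoch (the (g (G, H))) (the (f (F, G)))"
  have hom: "?c F G H \<in> hom BinStoch (dimension X F) (dimension Z H)"
    if "(F, G) \<in> dom f" "(G, H) \<in> dom g" for F G H
    using Comp_hom_BinStoch[OF family_hom[OF f(1) that(1)] family_hom[OF g(1) that(2)]] .
  have act: "act (?c F G H) z (observe X F x) = ?K (cylinder Z H z) x"
    if FG: "(F, G) \<in> dom f" and GH: "(G, H) \<in> dom g"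
      and z: "z \<in> bin_pow (dimension Z H)" and x: "x \<in> points X" for F G H z x
  proof -
    have G: "G \<in> FinLO (dom Y)" and H: "H \<in> FinLO (dom Z)"
      using family_FinLO[OF g(1) GH] by auto
    obtain f' where f': "the (f (F, G)) = Arr (dimension X F) (dimension Y G) f'"
      using family_hom[OF f(1) FG] unfolding hom_BinStoch by blast
    obtain g' where g': "the (g (G, H)) = Arr (dimension Y G) (dimension Z H) g'"
      using family_hom[OF g(1) GH] unfolding hom_BinStoch by blast
    have "?K (cylinder Z H z) x = (\<Sum>y\<in>observe Y G ` topspace (cantor Y).
        g' z y * k {p \<in> topspace (cantor Y). observe Y G p = y} x)"
    proof (rule kernel_comp_eq[OF compact_two_pow f(3) locally_constant_observe[OF G]])
      show "l (cylinder Z H z) y = g' z (observe Y G y)" if "y \<in> topspace (cantor Y)" for y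
        using representsD[OF g(2) GH z] that unfolding g' topspace_two_pow by simp
    qed (use cylinder_Clopen[OF H] x in \<open>simp_all add: topspace_two_pow\<close>)
    also have "\<dots> = (\<Sum>y\<in>bin_pow (dimension Y G). g' z y * f' y (observe X F x))"
      unfolding topspace_two_pow observe_image[OF Y G] cylinder_def[symmetric]
      by (intro sum.cong refl) (use representsD[OF f(2) FG _ x] f' in simp)
    also have "\<dots> = act (?c F G H) z (observe X F x)"
      unfolding f' g' Comp_BinStoch by simp
    finally show ?thesis ..
  qed
  have dom: "(F, H) \<in> dom ?h \<longleftrightarrow> (\<exists>G. (F, G) \<in> dom f \<and> (G, H) \<in> dom g)" for F H
    unfolding domIff[of "(F, H)"] family_comp_def by simp
  have val: "the (?h (F, H)) = ?c F G H" if FG: "(F, G) \<in> dom f" and GH: "(G, H) \<in> dom g" for F G H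
  proof -
    have F: "F \<in> FinLO (dom X)" using family_FinLO[OF f(1) FG] by blast
    have "?c F G' H = ?c F G H" if FG': "(F, G') \<in> dom f" and GH': "(G', H) \<in> dom g" for G'
    proof (rule hom_BinStoch_eqI[OF hom[OF FG' GH'] hom[OF FG GH]])
      fix z a assume z: "z \<in> bin_pow (dimension Z H)" and "a \<in> bin_pow (dimension X F)"
      then obtain x where x: "x \<in> points X" "a = observe X F x"
        unfolding observe_image[OF X F, symmetric] by blast
      show "act (?c F G' H) z a = act (?c F G H) z a"
        unfolding x(2) act[OF FG' GH' z x(1)] act[OF FG GH z x(1)] ..
    qed
    then have "(THE m. \<exists>G. (F, G) \<in> dom f \<and> (G, H) \<in> dom g \<and> m = ?c F G H) = ?c F G H"
      using FG GH by (intro the_equality) blast+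
    moreover have "\<exists>G. (F, G) \<in> dom f \<and> (G, H) \<in> dom g" using FG GH by blast
    ultimately show ?thesis unfolding family_comp_def by simp
  qed
  show r: "represents X Z ?h ?K"
    unfolding represents_def
  proof (intro ballI, clarify)
    fix F H z x m assume "?h (F, H) = Some m" and z: "z \<in> bin_pow (dimension Z H)" and x: "x \<in> points X"
    then obtain G where G: "(F, G) \<in> dom f" "(G, H) \<in> dom g" using dom by blast
    show "act (the (?h (F, H))) z (observe X F x) = ?K (cylinder Z H z) x"
      unfolding val[OF G] by (rule act[OF G z x])
  qed
  show "is_family X Z ?h"
  proof (rule family_if_represents[OF X Z _ _ _ _ lc_kernel_comp[OF compact_two_pow f(3) g(3)] r])
    show "dom ?h \<subseteq> FinLO (dom X) \<times> FinLO (dom Z)"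
      by (rule subrelI) (use dom family_FinLO[OF f(1)] family_FinLO[OF g(1)] in blast)
    show "the (?h (F, H)) \<in> hom BinStoch (dimension X F) (dimension Z H)" if FH: "(F, H) \<in> dom ?h" for F H
    proof -
      obtain G where G: "(F, G) \<in> dom f" "(G, H) \<in> dom g" using FH dom by blast
      show ?thesis unfolding val[OF G] by (rule hom[OF G])
    qed
    show "\<exists>F. (F, H) \<in> dom ?h" if "H \<in> FinLO (dom Z)" for H
      using that dom family_covering[OF f(1)] family_covering[OF g(1)] family_FinLO[OF g(1)] by metis
    show "(F', H) \<in> dom ?h" if "(F, H) \<in> dom ?h" "F' \<in> FinLO (dom X)" "F \<subseteq> F'" for F H F'
      using that dom family_hereditary[OF f(1)] by metis
  qed
qed

section \<open>The equivalence\<close>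

lemma family_kernel_unique:
  assumes "countable (dom X)" "countable (dom Y)"
    and "is_family X Y f" "represents X Y f k" "lc_kernel (cantor X) (cantor Y) k"
  shows "family_kernel X Y f = k"
proof -
  note fk = assms(3) represents_family_kernel[OF assms(2,3)] lc_kernel_family_kernel[OF assms(2,3)]
  have "(f, f) \<in> family_equiv BinStoch X Y"
    using assms(3) unfolding family_equiv_def by blast
  then show ?thesis
    using family_equiv_iff[OF assms(1,2) fk assms(3-5)] by blast
qed

abbreviation family_class :: "('j::linorder \<rightharpoonup> nat) \<Rightarrow> ('j \<rightharpoonup> nat) \<Rightarrow>
    ('j, (nat, bool list \<Rightarrow> bool list \<Rightarrow> real) arr) family \<Rightarrow>
    ('j, (nat, bool list \<Rightarrow> bool list \<Rightarrow> real) arr) family set" where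
  "family_class X Y f \<equiv> family_equiv BinStoch X Y `` {f}"

lemma family_class_eq_iff:
  assumes X: "countable (dom X)" and Y: "countable (dom Y)" and f: "is_family X Y f" and g: "is_family X Y g"
  shows "family_class X Y f = family_class X Y g \<longleftrightarrow> family_kernel X Y f = family_kernel X Y g"
proof -
  note fk = f represents_family_kernel[OF Y f] lc_kernel_family_kernel[OF Y f]
  note gk = g represents_family_kernel[OF Y g] lc_kernel_family_kernel[OF Y g]
  have "family_class X Y f = family_class X Y g \<longleftrightarrow> (f, g) \<in> family_equiv BinStoch X Y"
    using eq_equiv_class_iff[OF equiv_family_equiv[OF X Y], of f g] f g by simp
  then show ?thesis unfolding family_equiv_iff[OF X Y fk gk] .
qed

lemma in_family_class:
  assumes X: "countable (dom X)" and Y: "countable (dom Y)" and f: "is_family X Y f" and g: "g \<in> family_class X Y f"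
  shows "is_family X Y g" "family_kernel X Y g = family_kernel X Y f"
proof -
  have fg: "(f, g) \<in> family_equiv BinStoch X Y" using g by simp
  then show g: "is_family X Y g" unfolding family_equiv_def by simp
  note fk = f represents_family_kernel[OF Y f] lc_kernel_family_kernel[OF Y f]
  note gk = g represents_family_kernel[OF Y g] lc_kernel_family_kernel[OF Y g]
  show "family_kernel X Y g = family_kernel X Y f"
    using fg unfolding family_equiv_iff[OF X Y fk gk] by (rule sym)
qed

lemma self_in_family_class: "is_family X Y f \<Longrightarrow> f \<in> family_class X Y f"
  unfolding family_equiv_def by simp

text \<open>All members of a class have the same kernel, so the choice is immaterial.\<close>

definition to_cantor ::
  "('j::linorder \<rightharpoonup> nat, ('j, (nat, bool list \<Rightarrow> bool list \<Rightarrow> real) arr) family set) arr \<Rightarrow>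
   ((nat \<Rightarrow> bool) topology, (nat \<Rightarrow> bool) set \<Rightarrow> (nat \<Rightarrow> bool) \<Rightarrow> real) arr" where
  "to_cantor u = Arr (cantor (src u)) (cantor (tgt u))
     (family_kernel (src u) (tgt u) (SOME f. f \<in> act u))"

lemma to_cantor_class:
  assumes X: "countable (dom X)" and Y: "countable (dom Y)" and f: "is_family X Y f"
  shows "to_cantor (Arr X Y (family_class X Y f)) = Arr (cantor X) (cantor Y) (family_kernel X Y f)"
proof -
  have "(SOME g. g \<in> family_class X Y f) \<in> family_class X Y f"
    by (rule someI[where P = "\<lambda>g. g \<in> family_class X Y f"]) (rule self_in_family_class[OF f])
  from in_family_class(2)[OF X Y f this] show ?thesis
    unfolding to_cantor_def by simp
qed

lemma Obj_expl: "X \<in> Obj (expl BinStoch star) \<longleftrightarrow> countable (dom X) \<and> star \<in> dom X"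
  unfolding expl_def BinStoch_def by simp

lemma hom_expl:
  "u \<in> hom (expl BinStoch star) X Y \<longleftrightarrow>
    X \<in> Obj (expl BinStoch star) \<and> Y \<in> Obj (expl BinStoch star) \<and>
    (\<exists>f. is_family X Y f \<and> u = Arr X Y (family_class X Y f))"
  unfolding hom_def expl_def Let_def quotient_def by (cases u) auto

lemma Idn_expl: "Idn (expl BinStoch star) X = Arr X X (family_class X X (family_id BinStoch X))"
  unfolding expl_def Let_def by simp

lemma Comp_expl:
  assumes X: "countable (dom X)" and Y: "countable (dom Y)" and Z: "countable (dom Z)"
    and f: "is_family X Y f" and g: "is_family Y Z g"
  shows "Comp (expl BinStoch star) (Arr Y Z (family_class Y Z g)) (Arr X Y (family_class X Y f)) =
      Arr X Z (family_class X Z (family_comp BinStoch g f))"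
    and "family_kernel X Z (family_comp BinStoch g f) =
      kernel_comp (cantor X) (cantor Y) (cantor Z) (family_kernel Y Z g) (family_kernel X Y f)"
    and "is_family X Z (family_comp BinStoch g f)"
proof -
  have comp: "is_family X Z (family_comp BinStoch g' f') \<and> family_kernel X Z (family_comp BinStoch g' f') =
      kernel_comp (cantor X) (cantor Y) (cantor Z) (family_kernel Y Z g') (family_kernel X Y f')"
    if f': "is_family X Y f'" and g': "is_family Y Z g'" for f' g'
  proof -
    note fk = f' represents_family_kernel[OF Y f'] lc_kernel_family_kernel[OF Y f']
    note gk = g' represents_family_kernel[OF Z g'] lc_kernel_family_kernel[OF Z g']
    note c = family_family_comp[OF X Y Z fk gk]
    show ?thesis
      using c(1) family_kernel_unique[OF X Z c lc_kernel_comp[OF compact_two_pow fk(3) gk(3)]] by blast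
  qed
  show fam: "is_family X Z (family_comp BinStoch g f)"
    and "family_kernel X Z (family_comp BinStoch g f) =
      kernel_comp (cantor X) (cantor Y) (cantor Z) (family_kernel Y Z g) (family_kernel X Y f)"
    using comp[OF f g] by blast+
  have "family_class X Z (family_comp BinStoch g' f') = family_class X Z (family_comp BinStoch g f)"
    if "f' \<in> family_class X Y f" "g' \<in> family_class Y Z g" for f' g'
  proof -
    note f' = in_family_class[OF X Y f that(1)] and g' = in_family_class[OF Y Z g that(2)]
    show ?thesis
      unfolding family_class_eq_iff[OF X Z conjunct1[OF comp[OF f'(1) g'(1)]] fam]
      using comp[OF f'(1) g'(1)] comp[OF f g] f'(2) g'(2) by simp
  qed
  then have "(\<Union>f'\<in>family_class X Y f. \<Union>g'\<in>family_class Y Z g. family_class X Z (family_comp BinStoch g' f')) =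
      family_class X Z (family_comp BinStoch g f)"
    using self_in_family_class[OF f] self_in_family_class[OF g] by blast
  then show "Comp (expl BinStoch star) (Arr Y Z (family_class Y Z g)) (Arr X Y (family_class X Y f)) =
      Arr X Z (family_class X Z (family_comp BinStoch g f))"
    unfolding expl_def Let_def by simp
qed

lemma coords_infinite: "countable (dom X) \<Longrightarrow> infinite (bits X) \<Longrightarrow> coords X = UNIV"
  unfolding coords_def coord_def
  using to_nat_on_infinite[OF countable_bits] by (metis bij_betw_imp_surj_on)

lemma coords_finite: "finite (bits X) \<Longrightarrow> coords X = {..<card (bits X)}"
  unfolding coords_def coord_def
  using to_nat_on_finite by (metis bij_betw_imp_surj_on)

text \<open>A single factor \<open>2\<^sup>n\<close> at \<open>star\<close> yields \<open>2\<^sup>n\<close>; one bit for each of countably infinitely many indices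
  yields the Cantor space, and this is where infinitely many indices have to exist.\<close>

lemma cantor_surj:
  fixes star :: "'j::linorder"
  assumes inf: "infinite (UNIV :: 'j set)"
  shows "cantor ` Obj (expl BinStoch star) = Obj CantorStoch_lc"
proof -
  have Obj: "Obj CantorStoch_lc = insert (two_pow UNIV) (range (\<lambda>n. two_pow {..<n}))"
    unfolding CantorStoch_lc_def full_subcategory_def StoneStoch_lc_def
    using Stone_space_two_pow by auto
  show ?thesis
  proof (intro equalityI subsetI)
    fix T assume "T \<in> cantor ` Obj (expl BinStoch star)"
    then obtain X where "X \<in> Obj (expl BinStoch star)" and T: "T = cantor X" by blast
    then have X: "countable (dom X)" unfolding Obj_expl by blast
    show "T \<in> Obj CantorStoch_lc"
      unfolding Obj T using coords_infinite[OF X] coords_finite[of X]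
      by (cases "finite (bits X)") auto
  next
    fix T :: "(nat \<Rightarrow> bool) topology" assume "T \<in> Obj CantorStoch_lc"
    then consider "T = two_pow UNIV" | n where "T = two_pow {..<n}"
      unfolding Obj by blast
    then show "T \<in> cantor ` Obj (expl BinStoch star)"
    proof cases
      case 1
      obtain C where C: "countable C" "infinite (C :: 'j set)"
        using infinite_countable_subset'[OF inf] by blast
      define X where "X = (\<lambda>j. if j \<in> insert star C then Some (1::nat) else None)"
      have dom: "dom X = insert star C" unfolding X_def by (auto split: if_splits)
      have "bits X = insert star C \<times> {0}" unfolding bits_def dom by (auto simp: X_def)
      then have "infinite (bits X)" using C(2) by (auto dest: finite_cartesian_productD1)
      then have "coords X = UNIV" using C(1) by (intro coords_infinite) (simp add: dom)
      then show ?thesis using 1 C(1) by (intro image_eqI[of _ _ X]) (simp_all add: Obj_expl dom)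
    next
      case (2 n)
      define X where "X = [star \<mapsto> n]"
      have "bits X = {star} \<times> {..<n}" unfolding bits_def X_def by auto
      then have "coords X = {..<n}" using coords_finite[of X] by (simp add: card_cartesian_product)
      then show ?thesis using 2 by (intro image_eqI[of _ _ X]) (simp_all add: Obj_expl X_def)
    qed
  qed
qed

theorem corollary7p8:
  fixes star :: "'j::linorder"
  assumes "infinite (UNIV :: 'j set)"
  shows "equivalent_categories (expl BinStoch star) CantorStoch_lc"
proof (rule equivalent_categories_if_surj_fully_faithful[where Fo = cantor and Fm = to_cantor])
  let ?E = "expl BinStoch star"
  have cnt: "countable (dom X)" if "X \<in> Obj ?E" for X
    using that unfolding Obj_expl by blast
  show surj: "cantor ` Obj ?E = Obj CantorStoch_lc"
    by (rule cantor_surj[OF assms])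
  show "category CantorStoch_lc"
    unfolding CantorStoch_lc_def by (rule category_full_subcategory[OF category_StoneStoch_lc])
  have CIdn: "Idn CantorStoch_lc T = Arr T T (kernel_id T)" for T
    unfolding CantorStoch_lc_def full_subcategory_def using Idn_StoneStoch_lc by simp
  have CComp: "Comp CantorStoch_lc (Arr T V l) (Arr S T k) = Arr S V (kernel_comp S T V l k)" for S T V l k
    unfolding CantorStoch_lc_def full_subcategory_def using Comp_StoneStoch_lc by simp
  have Chom: "u \<in> hom CantorStoch_lc (cantor X) (cantor Y) \<longleftrightarrow>
      (\<exists>k. u = Arr (cantor X) (cantor Y) k \<and> lc_kernel (cantor X) (cantor Y) k)"
    if "X \<in> Obj ?E" "Y \<in> Obj ?E" for u X Y
  proof -
    have "cantor X \<in> Obj CantorStoch_lc" "cantor Y \<in> Obj CantorStoch_lc"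
      using surj that by blast+
    then have "u \<in> hom CantorStoch_lc (cantor X) (cantor Y) \<longleftrightarrow> u \<in> hom StoneStoch_lc (cantor X) (cantor Y)"
      unfolding CantorStoch_lc_def full_subcategory_def hom_def by auto
    then show ?thesis unfolding hom_StoneStoch_lc using Stone_space_two_pow by simp
  qed
  show "Dom ?E u \<in> Obj ?E" "Cod ?E u \<in> Obj ?E" if "u \<in> Mor ?E" for u
    using that unfolding expl_def Let_def by simp_all
  show "Idn ?E X \<in> hom ?E X X" and "to_cantor (Idn ?E X) = Idn CantorStoch_lc (cantor X)"
    if X: "X \<in> Obj ?E" for X
  proof -
    note id = family_family_id[OF cnt[OF X]]
    show "Idn ?E X \<in> hom ?E X X" unfolding hom_expl Idn_expl using X id(1) by blast
    show "to_cantor (Idn ?E X) = Idn CantorStoch_lc (cantor X)"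
      unfolding Idn_expl CIdn to_cantor_class[OF cnt[OF X] cnt[OF X] id(1)]
        family_kernel_unique[OF cnt[OF X] cnt[OF X] id lc_kernel_id] ..
  qed
  show "Comp ?E v u \<in> hom ?E X Z" and "to_cantor (Comp ?E v u) = Comp CantorStoch_lc (to_cantor v) (to_cantor u)"
    if u: "u \<in> hom ?E X Y" and v: "v \<in> hom ?E Y Z" for u v X Y Z
  proof -
    have X: "X \<in> Obj ?E" and Y: "Y \<in> Obj ?E" and Z: "Z \<in> Obj ?E"
      using u v unfolding hom_expl by blast+
    obtain f where f: "is_family X Y f" "u = Arr X Y (family_class X Y f)"
      using u unfolding hom_expl by blast
    obtain g where g: "is_family Y Z g" "v = Arr Y Z (family_class Y Z g)"
      using v unfolding hom_expl by blast
    note c = Comp_expl[OF cnt[OF X] cnt[OF Y] cnt[OF Z] f(1) g(1)]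
    show "Comp ?E v u \<in> hom ?E X Z"
      unfolding f(2) g(2) c(1) hom_expl using X Z c(3) by blast
    show "to_cantor (Comp ?E v u) = Comp CantorStoch_lc (to_cantor v) (to_cantor u)"
      unfolding f(2) g(2) c(1) to_cantor_class[OF cnt[OF X] cnt[OF Z] c(3)] c(2)
        to_cantor_class[OF cnt[OF X] cnt[OF Y] f(1)] to_cantor_class[OF cnt[OF Y] cnt[OF Z] g(1)] CComp ..
  qed
  show "bij_betw to_cantor (hom ?E X Y) (hom CantorStoch_lc (cantor X) (cantor Y))"
    if X: "X \<in> Obj ?E" and Y: "Y \<in> Obj ?E" for X Y
    unfolding bij_betw_def
  proof
    note XY = cnt[OF X] cnt[OF Y]
    show "inj_on to_cantor (hom ?E X Y)"
    proof (rule inj_onI)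
      fix u v assume "u \<in> hom ?E X Y" "v \<in> hom ?E X Y" and eq: "to_cantor u = to_cantor v"
      then obtain f g where f: "is_family X Y f" "u = Arr X Y (family_class X Y f)"
        and g: "is_family X Y g" "v = Arr X Y (family_class X Y g)"
        unfolding hom_expl by blast
      have "family_kernel X Y f = family_kernel X Y g"
        using eq unfolding f(2) g(2) to_cantor_class[OF XY f(1)] to_cantor_class[OF XY g(1)] by simp
      then show "u = v" unfolding f(2) g(2) family_class_eq_iff[OF XY f(1) g(1), symmetric] by simp
    qed
    show "to_cantor ` hom ?E X Y = hom CantorStoch_lc (cantor X) (cantor Y)"
    proof (intro equalityI subsetI)
      fix w assume "w \<in> to_cantor ` hom ?E X Y"
      then obtain u where "u \<in> hom ?E X Y" "w = to_cantor u" by blast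
      then obtain f where f: "is_family X Y f" "w = to_cantor (Arr X Y (family_class X Y f))"
        unfolding hom_expl by blast
      show "w \<in> hom CantorStoch_lc (cantor X) (cantor Y)"
        unfolding f(2) to_cantor_class[OF XY f(1)] Chom[OF X Y]
        using lc_kernel_family_kernel[OF XY(2) f(1)] by blast
    next
      fix w assume "w \<in> hom CantorStoch_lc (cantor X) (cantor Y)"
      then obtain k where w: "w = Arr (cantor X) (cantor Y) k" and k: "lc_kernel (cantor X) (cantor Y) k"
        unfolding Chom[OF X Y] by blast
      obtain f where f: "is_family X Y f" "represents X Y f k"
        using kernel_represented[OF XY k] by blast
      have "w = to_cantor (Arr X Y (family_class X Y f))"
        unfolding w to_cantor_class[OF XY f(1)] family_kernel_unique[OF XY f k] ..
      moreover have "Arr X Y (family_class X Y f) \<in> hom ?E X Y"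
        unfolding hom_expl using X Y f(1) by blast
      ultimately show "w \<in> to_cantor ` hom ?E X Y" by blast
    qed
  qed
qed

end
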